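(* For every $n\ge 1$, $$\tilde{J}_{(n)}^{(\alpha)}(X) = n!\sum_{\pi \in S_n} \binom{\alpha +n-1-\mathrm{des}(\pi)}{n} F_{\mathrm{Des}(P(\pi))}(x),$$ where $P(\pi)$ is the insertion tableau of $\pi$ given by the Robinson–Schensted correspondence.
   Context: Jack polynomials: over $\mathbb{Q}(\alpha)$, with $\alpha$ an indeterminate, let $\langle p_\lambda,p_\nu\rangle_\alpha=\delta_{\lambda\nu}z_\lambda\alpha^{\ell(\lambda)}$, where $z_\lambda=\prod_i i^{m_i}m_i!$ and $m_i$ is the number of parts of $\lambda$ equal to $i$. The integral form Jack symmetric functions $J_\mu^{(\alpha)}(X)$ are the unique family, indexed by partitions $\mu$, of symmetric functions that are pairwise orthogonal for $\langle\cdot,\cdot\rangle_\alpha$, are triangular (only monomial symmetric functions $m_\lambda$ with $\lambda\le\mu$ in dominance order appear in $J_\mu^{(\alpha)}$), and are normalized so that the coefficient of $m_{1^n}$ in $J_\mu^{(\alpha)}$ is $n!$ where $n=|\mu|$. For $\mu$ a partition of $n$, define $\tilde J_\mu^{(\alpha)}(X)=\alpha^nJ_\mu^{(1/\alpha)}(X)$. Binomial coefficients in $\alpha$ are polynomials in $\alpha$. For $\pi=\pi_1\cdots\pi_n\in S_n$, $\mathrm{des}(\pi)$ is the number of $i$ with $\pi_i>\pi_{i+1}$. $P(\pi)$ is the standard Young tableau obtained by successively row-inserting $\pi_1,\ldots,\pi_n$ into the empty tableau (French notation, first row at the bottom: an inserted value replaces the leftmost larger entry in the row, which is then inserted in the next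 row up, or is appended to the end of the row if there is no larger entry). For a standard Young tableau $T$ with $n$ cells, $\mathrm{Des}(T)\subseteq\{1,\ldots,n-1\}$ is the set of entries $i$ such that $i+1$ lies above, or above and to the left of, $i$ (equivalently, $i+1$ is in a strictly higher row). For $\sigma\subseteq\{1,\ldots,n-1\}$ the fundamental quasisymmetric function is $$F_\sigma(x)=\sum_{\substack{i_1\le\cdots\le i_n\\ j\in\sigma\Rightarrow i_j<i_{j+1}}}x_{i_1}\cdots x_{i_n}.$$ *)

theory Defs
  imports
    "HOL-Library.Multiset"
    "HOL-Combinatorics.Multiset_Permutations"
    "HOL-Computational_Algebra.Computational_Algebra"
    "HOL-Computational_Algebra.Field_as_Ring"
begin

section \<open>The field of rational functions in one indeterminate\<close>

type_synonym ratfun = "rat poly fract"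

definition alpha :: ratfun where
  "alpha = to_fract [:0, 1:]"

text \<open>
  Substitution of \<open>t\<close> for the indeterminate in a rational function, computed from its
  reduced fraction; it is meaningful when the denominator does not vanish at \<open>t\<close>
  (always the case for \<open>t = 1 / alpha\<close>).
\<close>

definition subst_alpha :: "ratfun \<Rightarrow> ratfun \<Rightarrow> ratfun" where
  "subst_alpha t x =
     (let (a, b) = quot_of_fract x
      in poly (map_poly of_rat a) t / poly (map_poly of_rat b) t)"

section \<open>Power series in infinitely many commuting variables\<close>

text \<open>
  The variables \<open>x\<^sub>i\<close> are indexed by all natural numbers, starting at 0.
  A monomial is the multiset of the indices of its variables, and a formal power series is
  its coefficient function on monomials.
\<close>

type_synonym 'k mseries = "nat multiset \<Rightarrow> 'k"

definition ms_one :: "'k::comm_ring_1 mseries" where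
  "ms_one = (\<lambda>m. if m = {#} then 1 else 0)"

definition ms_mult :: "'k::comm_ring_1 mseries \<Rightarrow> 'k mseries \<Rightarrow> 'k mseries" where
  "ms_mult f g = (\<lambda>m. \<Sum>(a, b) \<in> {(a, b). a + b = m}. f a * g b)"

text \<open>
  The generating series of a set of words: the sum of \<open>x\<^bsub>w ! 0\<^esub> x\<^bsub>w ! 1\<^esub> \<dots>\<close> over all
  \<open>w \<in> W\<close>. Each monomial arises from finitely many words only.
\<close>

definition word_series :: "nat list set \<Rightarrow> 'k::comm_ring_1 mseries" where
  "word_series W = (\<lambda>m. of_nat (card {w \<in> W. mset w = m}))"

definition symmetric_function :: "'k::comm_ring_1 mseries \<Rightarrow> bool" where
  "symmetric_function f \<longleftrightarrow>
     (\<exists>d. \<forall>m. size m > d \<longrightarrow> f m = 0) \<and>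
     (\<forall>\<pi>. bij \<pi> \<longrightarrow> (\<forall>m. f (image_mset \<pi> m) = f m))"

section \<open>Partitions\<close>

text \<open>Partitions are weakly decreasing lists of positive parts.\<close>

definition is_partition :: "nat list \<Rightarrow> bool" where
  "is_partition lam \<longleftrightarrow> sorted_wrt (\<ge>) lam \<and> 0 \<notin> set lam"

definition dominance_le :: "nat list \<Rightarrow> nat list \<Rightarrow> bool" where
  "dominance_le lam mu \<longleftrightarrow>
     sum_list lam = sum_list mu \<and>
     (\<forall>k. sum_list (take k lam) \<le> sum_list (take k mu))"

definition z_part :: "nat list \<Rightarrow> nat" where
  "z_part lam = (\<Prod>i\<in>set lam. i ^ count_list lam i * fact (count_list lam i))"

section \<open>Bases of the symmetric functions\<close>

definition monomial_sym :: "nat list \<Rightarrow> 'k::comm_ring_1 mseries" where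
  "monomial_sym lam = (\<lambda>m. if image_mset (count m) (mset_set (set_mset m)) = mset lam then 1 else 0)"

definition power_sum :: "nat \<Rightarrow> 'k::comm_ring_1 mseries" where
  "power_sum r = word_series {replicate r i | i. True}"

definition power_sum_part :: "nat list \<Rightarrow> 'k::comm_ring_1 mseries" where
  "power_sum_part lam = foldr (\<lambda>r. ms_mult (power_sum r)) lam ms_one"

definition part_expansion ::
  "(nat list \<Rightarrow> 'k::comm_ring_1 mseries) \<Rightarrow> 'k mseries \<Rightarrow> (nat list \<Rightarrow> 'k) \<Rightarrow> bool" where
  "part_expansion b f c \<longleftrightarrow>
     finite {lam. c lam \<noteq> 0} \<and>
     (\<forall>lam. c lam \<noteq> 0 \<longrightarrow> is_partition lam) \<and>
     f = (\<lambda>m. \<Sum>lam | c lam \<noteq> 0. c lam * b lam m)"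

text \<open>
  The coefficients of \<open>f\<close> with respect to \<open>b\<close>, when \<open>b\<close> restricted to partitions is a basis of
  the symmetric functions and \<open>f\<close> is symmetric. Over a field of characteristic 0 both
  \<open>monomial_sym\<close> and \<open>power_sum_part\<close> are such bases.
\<close>

definition part_coeff ::
  "(nat list \<Rightarrow> 'k::comm_ring_1 mseries) \<Rightarrow> 'k mseries \<Rightarrow> nat list \<Rightarrow> 'k" where
  "part_coeff b f = (THE c. part_expansion b f c)"

section \<open>Jack symmetric functions\<close>

definition power_sum_pairing :: "nat list \<Rightarrow> nat list \<Rightarrow> ratfun" where
  "power_sum_pairing lam nu =
     (if lam = nu then of_nat (z_part lam) * alpha ^ length lam else 0)"

definition jack_inner :: "ratfun mseries \<Rightarrow> ratfun mseries \<Rightarrow> ratfun" where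
  "jack_inner f g =
     (let c = part_coeff power_sum_part f; d = part_coeff power_sum_part g
      in \<Sum>lam | c lam \<noteq> 0. \<Sum>nu | d nu \<noteq> 0. c lam * d nu * power_sum_pairing lam nu)"

text \<open>
  The conditions characterizing the family of integral form Jack symmetric functions; values
  of the family at lists that are not partitions are irrelevant.
\<close>

definition integral_jack_family :: "(nat list \<Rightarrow> ratfun mseries) \<Rightarrow> bool" where
  "integral_jack_family J \<longleftrightarrow>
     (\<forall>mu. is_partition mu \<longrightarrow> symmetric_function (J mu)) \<and>
     (\<forall>mu nu. is_partition mu \<longrightarrow> is_partition nu \<longrightarrow> mu \<noteq> nu \<longrightarrow> jack_inner (J mu) (J nu) = 0) \<and>
     (\<forall>mu lam. is_partition mu \<longrightarrow> is_partition lam \<longrightarrow>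
        part_coeff monomial_sym (J mu) lam \<noteq> 0 \<longrightarrow> dominance_le lam mu) \<and>
     (\<forall>mu. is_partition mu \<longrightarrow>
        part_coeff monomial_sym (J mu) (replicate (sum_list mu) 1) = fact (sum_list mu))"

definition jack_tilde :: "(nat list \<Rightarrow> ratfun mseries) \<Rightarrow> nat list \<Rightarrow> ratfun mseries" where
  "jack_tilde J mu = (\<lambda>m. alpha ^ sum_list mu * subst_alpha (1 / alpha) (J mu m))"

section \<open>Permutations, tableaux and fundamental quasisymmetric functions\<close>

text \<open>Permutations are given as words in one-line notation.\<close>

definition des :: "nat list \<Rightarrow> nat" where
  "des w = card {i. Suc i < length w \<and> w ! i > w ! Suc i}"

text \<open>Row insertion returns the new row and the bumped entry, if any.\<close>

fun row_insert :: "nat \<Rightarrow> nat list \<Rightarrow> nat list \<times> nat option" where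
  "row_insert x [] = ([x], None)"
| "row_insert x (y # ys) =
     (if x < y then (x # ys, Some y)
      else (let (r, b) = row_insert x ys in (y # r, b)))"

text \<open>Tableaux are lists of rows in French notation: the bottom row comes first.\<close>

fun tableau_insert :: "nat \<Rightarrow> nat list list \<Rightarrow> nat list list" where
  "tableau_insert x [] = [[x]]"
| "tableau_insert x (r # rs) =
     (case row_insert x r of
        (r', None) \<Rightarrow> r' # rs
      | (r', Some y) \<Rightarrow> r' # tableau_insert y rs)"

definition insertion_tableau :: "nat list \<Rightarrow> nat list list" where
  "insertion_tableau w = fold tableau_insert w []"

definition Des :: "nat list list \<Rightarrow> nat set" where
  "Des T = {i. \<exists>r s. r < s \<and> s < length T \<and> i \<in> set (T ! r) \<and> Suc i \<in> set (T ! s)}"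

text \<open>
  For \<open>\<sigma> \<subseteq> {1..n-1}\<close>; the \<open>j\<close>-th letter of \<open>w\<close> is \<open>w ! (j - 1)\<close>.
\<close>

definition fundamental_qsym :: "nat \<Rightarrow> nat set \<Rightarrow> 'k::comm_ring_1 mseries" where
  "fundamental_qsym n \<sigma> =
     word_series {w. length w = n \<and> sorted w \<and> (\<forall>j\<in>\<sigma>. w ! (j - 1) < w ! j)}"

end

theory Submission
  imports Defs "HOL-Library.Function_Algebras"
begin

text \<open>
  Write \<open>h\<close> for the series whose coefficient at a monomial with exponents \<open>m\<^sub>i\<close> is
  \<open>\<Prod>\<^sub>i ((1/\<alpha> + m\<^sub>i - 1) gchoose m\<^sub>i)\<close>, restricted to degree \<open>n\<close>. Newton's recursion gives
  \<open>h = \<Sum>\<^bsub>lam\<^esub> z\<^bsub>lam\<^esub>\<^sup>-\<^sup>1 \<alpha>\<^sup>-\<^sup>l p\<^bsub>lam\<^esub>\<close> (\<open>l\<close> the length of \<open>lam\<close>), so pairing with \<open>h\<close> extracts the coefficient of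
  \<open>x\<^sub>0\<^sup>n\<close>. By triangularity this coefficient vanishes in every Jack function other than that of
  \<open>(n)\<close>. The pairing is positive definite in the ordering of \<open>\<rat>(\<alpha>)\<close> with \<open>\<alpha>\<close> infinitely large, so
  the Jack functions of degree \<open>n\<close> form an orthogonal basis, and \<open>h\<close> is a multiple of the Jack
  function of \<open>(n)\<close>; the normalization fixes the multiple.

  On the other side, \<open>Des(P(\<pi>))\<close> is the set of \<open>i\<close> such that \<open>i + 1\<close> precedes \<open>i\<close> in \<open>\<pi>\<close>. Hence the
  permutations contributing to the coefficient of a monomial are the standardizations of the words
  with that content, and standardization preserves descents. The resulting sum over words satisfies
  the same recursion under \<open>\<alpha> \<mapsto> \<alpha> + 1\<close> as \<open>\<Prod>\<^sub>i ((\<alpha> + m\<^sub>i - 1) gchoose m\<^sub>i)\<close>, and both are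
  polynomials in \<open>\<alpha>\<close> that agree at \<open>\<alpha> = 0\<close>.
\<close>

section \<open>Descents of the insertion tableau\<close>

text \<open>\<open>y\<close> is the leftmost entry exceeding \<open>x\<close>; sortedness turns this
  into the bounds on \<open>l\<close> and \<open>r\<close>. The elimination form serves as the case
  split in the arguments over rows below.\<close>

lemma row_insert_cases:
  assumes "sorted R"
  obtains (append) "row_insert x R = (R @ [x], None)" "\<And>z. z \<in> set R \<Longrightarrow> z \<le> x"
  | (bump) l y r where "R = l @ y # r" "row_insert x R = (l @ x # r, Some y)" "x < y"
      "\<And>z. z \<in> set l \<Longrightarrow> z \<le> x" "\<And>z. z \<in> set r \<Longrightarrow> y \<le> z"
  using assms
proof (induction R arbitrary: thesis)
  case Nil
  then show ?case by simp
next
  case (Cons a R)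
  show ?case
  proof (cases "x < a")
    case True
    then show ?thesis using Cons.prems(2)[of "[]" a R] Cons.prems(3) by simp
  next
    case False
    show ?thesis
    proof (rule Cons.IH)
      assume "row_insert x R = (R @ [x], None)" "\<And>z. z \<in> set R \<Longrightarrow> z \<le> x"
      then show thesis using Cons.prems(1) False by (auto simp: not_less)
    next
      fix l y r
      assume "R = l @ y # r" "row_insert x R = (l @ x # r, Some y)" "x < y"
        "\<And>z. z \<in> set l \<Longrightarrow> z \<le> x" "\<And>z. z \<in> set r \<Longrightarrow> y \<le> z"
      then show thesis by (intro Cons.prems(2)[of "a # l" y r]) (use False in auto)
    qed (use Cons.prems in auto)
  qed
qed

lemma mset_concat_tableau_insert:
  assumes "\<forall>R\<in>set T. sorted R"
  shows "mset (concat (tableau_insert x T)) = add_mset x (mset (concat T))"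
  using assms
proof (induction T arbitrary: x)
  case (Cons R T)
  have "sorted R" using Cons.prems by simp
  show ?case using Cons by (cases rule: row_insert_cases[OF \<open>sorted R\<close>, of x, case_names append bump]) auto
qed simp

lemma sorted_rows_tableau_insert:
  assumes "\<forall>R\<in>set T. sorted R"
  shows "\<forall>R\<in>set (tableau_insert x T). sorted R"
  using assms
proof (induction T arbitrary: x)
  case (Cons R T)
  have "sorted R" using Cons.prems by simp
  show ?case
  proof (cases rule: row_insert_cases[OF \<open>sorted R\<close>, of x, case_names append bump])
    case (bump l y r)
    then have "sorted (l @ x # r)" using \<open>sorted R\<close> by (force simp: sorted_append)
    then show ?thesis using Cons bump by simp
  qed (use Cons in \<open>auto simp: sorted_append\<close>)
qed simp

definition entries :: "'a list list \<Rightarrow> 'a set" where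
  "entries T = set (concat T)"

lemma entries_Nil [simp]: "entries [] = {}"
  and entries_Cons [simp]: "entries (R # T) = set R \<union> entries T"
  by (auto simp: entries_def)

text \<open>Peeling off the bottom row replaces row indices by a recursion that runs parallel to
  \<open>tableau_insert\<close>.\<close>

lemma Des_Cons:
  "i \<in> Des (R # T) \<longleftrightarrow> i \<in> set R \<and> Suc i \<in> entries T \<or> i \<in> Des T"
proof
  assume "i \<in> Des (R # T)"
  then obtain r s where rs: "r < s" "s < Suc (length T)" "i \<in> set ((R # T) ! r)"
      "Suc i \<in> set ((R # T) ! s)"
    by (auto simp: Des_def)
  then obtain s' where s': "s = Suc s'" by (cases s) auto
  show "i \<in> set R \<and> Suc i \<in> entries T \<or> i \<in> Des T"
  proof (cases r)
    case 0
    then show ?thesis using rs s' by (auto simp: entries_def)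
  next
    case (Suc r')
    then show ?thesis using rs s' by (auto simp: Des_def)
  qed
next
  assume "i \<in> set R \<and> Suc i \<in> entries T \<or> i \<in> Des T"
  then show "i \<in> Des (R # T)"
  proof (elim disjE conjE)
    assume "i \<in> set R" "Suc i \<in> entries T"
    moreover from this obtain s where "s < length T" "Suc i \<in> set (T ! s)"
      by (auto simp: entries_def in_set_conv_nth[of _ T])
    ultimately show ?thesis unfolding Des_def
      by (intro CollectI exI[of _ 0] exI[of _ "Suc s"]) auto
  next
    assume "i \<in> Des T"
    then obtain r s where "r < s" "s < length T" "i \<in> set (T ! r)" "Suc i \<in> set (T ! s)"
      by (auto simp: Des_def)
    then show ?thesis unfolding Des_def
      by (intro CollectI exI[of _ "Suc r"] exI[of _ "Suc s"]) auto
  qed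
qed

lemma Des_imp_in_set:
  assumes "i \<in> Des T"
  shows "i \<in> entries T" "Suc i \<in> entries T"
  using assms unfolding Des_def by (auto simp: entries_def intro!: bexI nth_mem)

lemma entries_tableau_insert:
  assumes "\<forall>R\<in>set T. sorted R"
  shows "entries (tableau_insert x T) = insert x (entries T)"
  using mset_concat_tableau_insert[OF assms, THEN arg_cong[where f = set_mset]]
  unfolding entries_def by (metis set_mset_add_mset_insert set_mset_mset)

text \<open>The new \<open>i\<close> settles in the bottom row. If \<open>Suc i\<close> is also
  there, it is the leftmost entry exceeding \<open>i\<close> and is bumped, so in either case
  \<open>Suc i\<close> ends in a higher row.\<close>

lemma Des_tableau_insert_self:
  assumes "\<forall>R\<in>set T. sorted R" "distinct (concat T)" "i \<notin> entries T" "Suc i \<in> entries T"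
  shows "i \<in> Des (tableau_insert i T)"
proof (cases T)
  case Nil
  then show ?thesis using assms by simp
next
  case (Cons R T')
  have "sorted R" using assms Cons by simp
  show ?thesis
  proof (cases rule: row_insert_cases[OF \<open>sorted R\<close>, of i, case_names append bump])
    case append
    then show ?thesis using assms Cons by (force simp: Des_Cons)
  next
    case (bump l y r)
    have "Suc i \<in> entries (tableau_insert y T')"
    proof (cases "Suc i = y")
      case False
      then have "Suc i \<notin> set R" using bump by force
      then show ?thesis using assms Cons by (simp add: entries_tableau_insert)
    qed (use assms Cons in \<open>simp add: entries_tableau_insert\<close>)
    then show ?thesis using Cons bump by (simp add: Des_Cons)
  qed
qed

text \<open>The new \<open>Suc i\<close> settles in the bottom row. It did not occur before and a
  bumped entry exceeds it, so no higher row contains it.\<close>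

lemma Des_tableau_insert_Suc:
  assumes "\<forall>R\<in>set T. sorted R" "distinct (concat T)" "Suc i \<notin> entries T"
  shows "i \<notin> Des (tableau_insert (Suc i) T)"
proof (cases T)
  case Nil
  then show ?thesis by (simp add: Des_Cons) (simp add: Des_def)
next
  case (Cons R T')
  have "sorted R" using assms Cons by simp
  show ?thesis
  proof (cases rule: row_insert_cases[OF \<open>sorted R\<close>, of "Suc i", case_names append bump])
    case append
    then show ?thesis using assms Cons Des_imp_in_set(2)[of i T'] by (auto simp: Des_Cons)
  next
    case (bump l y r)
    have "Suc i \<notin> entries (tableau_insert y T')"
      using assms Cons bump by (subst entries_tableau_insert) auto
    then show ?thesis using Cons bump Des_imp_in_set(2)[of i] by (auto simp: Des_Cons)
  qed
qed

text \<open>Induction over the rows. The inserted value is neither \<open>i\<close> nor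
  \<open>Suc i\<close>, but the value bumped into the next row can be either; the preceding two
  lemmas settle these cases.\<close>

lemma Des_tableau_insert_other:
  assumes "\<forall>R\<in>set T. sorted R" "distinct (concat T)" "x \<notin> entries T" "x \<noteq> i" "x \<noteq> Suc i"
  shows "i \<in> Des (tableau_insert x T) \<longleftrightarrow> i \<in> Des T"
  using assms
proof (induction T arbitrary: x)
  case Nil
  then show ?case by (simp add: Des_Cons)
next
  case (Cons R T)
  have T: "\<forall>R\<in>set T. sorted R" "distinct (concat T)" using Cons.prems by auto
  have "sorted R" using Cons.prems by simp
  show ?case
  proof (cases rule: row_insert_cases[OF \<open>sorted R\<close>, of x, case_names append bump])
    case append
    then show ?thesis using Cons.prems by (simp add: Des_Cons)
  next
    case (bump l y r)
    have y: "y \<notin> entries T" "y \<notin> set l" "y \<notin> set r"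
      using Cons.prems bump by (auto simp: entries_def)
    consider "y = i" | "y = Suc i" | "y \<noteq> i" "y \<noteq> Suc i" by blast
    then show ?thesis
    proof cases
      case 1
      \<comment> \<open>The bumped \<open>i\<close> moves to the bottom row of \<open>T\<close>, so
        it remains a descent exactly when \<open>Suc i\<close> already was in
        \<open>T\<close>.\<close>
      have "i \<in> Des (tableau_insert i T) \<longleftrightarrow> Suc i \<in> entries T"
        using y 1 Des_tableau_insert_self[OF T] Des_imp_in_set(2)[of i "tableau_insert i T"]
        by (auto simp: entries_tableau_insert[OF T(1)])
      moreover have "i \<notin> Des T" using y 1 Des_imp_in_set(1) by blast
      ultimately show ?thesis using y bump Cons.prems 1 by (simp add: Des_Cons)
    next
      case 2
      \<comment> \<open>Here \<open>x < i\<close>, and \<open>Suc i\<close> is the leftmost entry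
        exceeding \<open>x\<close>, so the row cannot contain \<open>i\<close>.\<close>
      have "i \<notin> set l" "i \<notin> set r" using bump Cons.prems 2 by force+
      moreover have "i \<notin> Des (tableau_insert (Suc i) T)"
        using y 2 by (intro Des_tableau_insert_Suc[OF T]) simp
      moreover have "i \<notin> Des T" using y 2 Des_imp_in_set(2) by blast
      ultimately show ?thesis using y bump Cons.prems 2 by (simp add: Des_Cons)
    next
      case 3
      then show ?thesis
        using y bump Cons.prems Cons.IH[OF T, of y]
        by (auto simp: Des_Cons entries_tableau_insert[OF T(1)])
    qed
  qed
qed

section \<open>Order of occurrence of letters in a word\<close>

primrec precedes :: "'a \<Rightarrow> 'a \<Rightarrow> 'a list \<Rightarrow> bool" where
  "precedes x y [] \<longleftrightarrow> False"
| "precedes x y (z # w) \<longleftrightarrow> x = z \<and> y \<in> set w \<or> precedes x y w"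

lemma precedes_append:
  "precedes x y (v @ w) \<longleftrightarrow> precedes x y v \<or> precedes x y w \<or> x \<in> set v \<and> y \<in> set w"
  by (induction v) auto

lemma precedes_imp_in_set: "precedes x y w \<Longrightarrow> x \<in> set w \<and> y \<in> set w"
  by (induction w) auto

lemma precedes_total: "x \<in> set w \<Longrightarrow> y \<in> set w \<Longrightarrow> x \<noteq> y \<Longrightarrow> precedes x y w \<or> precedes y x w"
  by (induction w) auto

lemma precedes_asym: "distinct w \<Longrightarrow> precedes x y w \<Longrightarrow> \<not> precedes y x w"
  by (induction w) (auto dest: precedes_imp_in_set)

lemma precedes_trans: "distinct w \<Longrightarrow> precedes x y w \<Longrightarrow> precedes y z w \<Longrightarrow> precedes x z w"
  by (induction w) (auto dest: precedes_imp_in_set)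

lemma precedes_nth: "i < j \<Longrightarrow> j < length w \<Longrightarrow> precedes (w ! i) (w ! j) w"
proof (induction w arbitrary: i j)
  case (Cons z w)
  then obtain j' where j: "j = Suc j'" "j' < length w" by (cases j) auto
  show ?case
  proof (cases i)
    case 0
    then show ?thesis using j by simp
  next
    case (Suc i')
    then show ?thesis using j Cons.prems Cons.IH[of i' j'] by simp
  qed
qed simp

lemma precedes_conv_nth:
  "precedes x y w \<Longrightarrow> \<exists>i j. i < j \<and> j < length w \<and> w ! i = x \<and> w ! j = y"
proof (induction w)
  case (Cons z w)
  then consider "x = z" "y \<in> set w" | "precedes x y w" by auto
  then show ?case
  proof cases
    case 1
    then obtain j where "j < length w" "w ! j = y" by (auto simp: in_set_conv_nth)
    then show ?thesis using 1 by (intro exI[of _ 0] exI[of _ "Suc j"]) auto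
  next
    case 2
    then obtain i j where "i < j" "j < length w" "w ! i = x" "w ! j = y" using Cons by blast
    then show ?thesis by (intro exI[of _ "Suc i"] exI[of _ "Suc j"]) auto
  qed
qed simp

lemma insertion_tableau_snoc:
  "insertion_tableau (w @ [x]) = tableau_insert x (insertion_tableau w)"
  by (simp add: insertion_tableau_def)

lemma insertion_tableau_rows:
  shows sorted_rows_insertion_tableau: "\<forall>R\<in>set (insertion_tableau w). sorted R"
    and mset_concat_insertion_tableau: "mset (concat (insertion_tableau w)) = mset w"
  by (induction w rule: rev_induct)
    (simp_all add: insertion_tableau_snoc sorted_rows_tableau_insert mset_concat_tableau_insert
      insertion_tableau_def[of "[]"] del: mset_concat)

text \<open>Letters are inserted one at a time, and only \<open>i\<close> and \<open>Suc i\<close>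
  affect the status of \<open>i\<close>: a last letter \<open>i\<close> makes it a descent exactly
  when \<open>Suc i\<close> has already occurred, a last letter \<open>Suc i\<close> never
  does.\<close>

lemma Des_insertion_tableau:
  assumes "distinct w"
  shows "i \<in> Des (insertion_tableau w) \<longleftrightarrow> precedes (Suc i) i w"
  using assms
proof (induction w rule: rev_induct)
  case Nil
  then show ?case by (simp add: insertion_tableau_def Des_def)
next
  case (snoc x w)
  let ?T = "insertion_tableau w"
  note rows = sorted_rows_insertion_tableau[of w]
  have dist: "distinct (concat ?T)" and set: "entries ?T = set w"
    using mset_concat_insertion_tableau[of w] snoc.prems
    by (metis distinct_append mset_eq_imp_distinct_iff, metis entries_def set_mset_mset)
  have in_w: "Suc i \<in> set w \<and> i \<in> set w" if "precedes (Suc i) i w"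
    using that by (auto dest: precedes_imp_in_set)
  consider "x = i" | "x = Suc i" | "x \<noteq> i" "x \<noteq> Suc i" by blast
  then show ?case
  proof cases
    case 1
    then show ?thesis
      using snoc Des_tableau_insert_self[OF rows dist, of i] Des_imp_in_set(2)[of i "tableau_insert i ?T"]
        set entries_tableau_insert[OF rows, of i] in_w
      by (auto simp: insertion_tableau_snoc precedes_append)
  next
    case 2
    then show ?thesis
      using snoc Des_tableau_insert_Suc[OF rows dist, of i] set in_w
      by (auto simp: insertion_tableau_snoc precedes_append)
  next
    case 3
    then show ?thesis
      using snoc Des_tableau_insert_other[OF rows dist, of x i] set
      by (auto simp: insertion_tableau_snoc precedes_append)
  qed
qed

section \<open>Standardization\<close>

text \<open>For \<open>g\<close> weakly increasing on \<open>{1..n}\<close> and a permutation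
  \<open>\<pi>\<close> of that set, this says that \<open>\<pi>\<close> is the standardization of
  \<open>map g \<pi>\<close>: equal letters are numbered from left to right.\<close>

definition standard_for :: "(nat \<Rightarrow> 'a::linorder) \<Rightarrow> nat list \<Rightarrow> bool" where
  "standard_for g \<pi> \<longleftrightarrow> (\<forall>i. precedes (Suc i) i \<pi> \<longrightarrow> g i < g (Suc i))"

text \<open>Monotonicity makes \<open>g\<close> constant from \<open>x\<close> to \<open>y\<close>,
  so no consecutive pair in between occurs in reversed order; transitivity chains these
  pairs.\<close>

lemma standard_for_precedes:
  assumes "standard_for g \<pi>" "distinct \<pi>" "set \<pi> = {1..n}" "mono_on {1..n} g"
    and "1 \<le> x" "x < y" "y \<le> n" "g x = g y"
  shows "precedes x y \<pi>"
proof -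
  have "Suc x \<le> y" using assms by simp
  then show ?thesis using \<open>y \<le> n\<close> \<open>g x = g y\<close>
  proof (induction y rule: dec_induct)
    case base
    then show ?case
      using assms(1,3,5) precedes_total[of x \<pi> "Suc x"] by (auto simp: standard_for_def)
  next
    case (step z)
    have "g x \<le> g z" "g z \<le> g (Suc z)"
      using assms(5) step.hyps step.prems(1) by (auto intro: mono_onD[OF assms(4)])
    then have eq: "g x = g z" "g z = g (Suc z)" using step.prems by auto
    then have "precedes x z \<pi>" using step by simp
    moreover have "precedes z (Suc z) \<pi>"
      using assms(1,3,5) precedes_total[of z \<pi> "Suc z"] eq step.hyps step.prems
      by (auto simp: standard_for_def)
    ultimately show ?case using precedes_trans[OF assms(2)] by blast
  qed
qed

text \<open>Since \<open>g\<close> is monotone, a descent of \<open>\<pi>\<close> could only be lost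
  to two equal letters, but these are numbered from left to right. No descent is gained, again by
  monotonicity.\<close>

lemma des_map_standard_for:
  fixes g :: "nat \<Rightarrow> nat"
  assumes "standard_for g \<pi>" "distinct \<pi>" "set \<pi> = {1..n}" "mono_on {1..n} g"
  shows "des (map g \<pi>) = des \<pi>"
proof -
  have "g (\<pi> ! i) > g (\<pi> ! Suc i) \<longleftrightarrow> \<pi> ! i > \<pi> ! Suc i" if i: "Suc i < length \<pi>" for i
  proof -
    have range: "\<pi> ! i \<in> {1..n}" "\<pi> ! Suc i \<in> {1..n}"
      unfolding assms(3)[symmetric] using i by (auto intro: nth_mem)
    have pre: "precedes (\<pi> ! i) (\<pi> ! Suc i) \<pi>" using i by (intro precedes_nth) auto
    show ?thesis
    proof
      assume "g (\<pi> ! i) > g (\<pi> ! Suc i)"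
      then show "\<pi> ! i > \<pi> ! Suc i" using mono_onD[OF assms(4) range] by linarith
    next
      assume less: "\<pi> ! i > \<pi> ! Suc i"
      then have "g (\<pi> ! i) \<ge> g (\<pi> ! Suc i)" using mono_onD[OF assms(4) range(2,1)] by simp
      moreover have "g (\<pi> ! i) \<noteq> g (\<pi> ! Suc i)"
      proof
        assume "g (\<pi> ! i) = g (\<pi> ! Suc i)"
        then have "precedes (\<pi> ! Suc i) (\<pi> ! i) \<pi>"
          using range by (intro standard_for_precedes[OF assms _ less]) (simp_all only: atLeastAtMost_iff)
        then show False using precedes_asym[OF assms(2) pre] by blast
      qed
      ultimately show "g (\<pi> ! i) > g (\<pi> ! Suc i)" by simp
    qed
  qed
  then have "{i. Suc i < length (map g \<pi>) \<and> map g \<pi> ! i > map g \<pi> ! Suc i} =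
      {i. Suc i < length \<pi> \<and> \<pi> ! i > \<pi> ! Suc i}"
    by (intro Collect_cong) (simp cong: conj_cong)
  then show ?thesis by (simp only: des_def)
qed

text \<open>Take the first position \<open>i\<close> where two such permutations differ, say with
  \<open>p ! i < q ! i\<close>. Both carry the same letter there, so \<open>p ! i\<close> comes
  before \<open>q ! i\<close> in \<open>q\<close>, at a position where \<open>p\<close> and
  \<open>q\<close> still agree. Then \<open>p\<close> contains \<open>p ! i\<close> twice.\<close>

lemma inj_on_map_standard_for:
  assumes "mono_on {1..n} g"
  shows "inj_on (map g) {\<pi> \<in> permutations_of_set {1..n}. standard_for g \<pi>}"
proof (rule inj_onI)
  fix p q
  assume p: "p \<in> {\<pi> \<in> permutations_of_set {1..n}. standard_for g \<pi>}"
    and q: "q \<in> {\<pi> \<in> permutations_of_set {1..n}. standard_for g \<pi>}"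
    and eq: "map g p = map g q"
  have first_difference: False
    if p: "standard_for g p" "distinct p" "set p = {1..n}"
      and q: "standard_for g q" "distinct q" "set q = {1..n}"
      and len: "length p = length q" and i: "i < length p"
      and g: "g (p ! i) = g (q ! i)" and less: "p ! i < q ! i"
      and before: "\<forall>j<i. p ! j = q ! j" for p q i
  proof -
    have pi: "p ! i \<in> {1..n}" using nth_mem[OF i] p(3) by simp
    have qi: "q ! i \<in> {1..n}" using nth_mem[of i q] i len q(3) by simp
    have "precedes (p ! i) (q ! i) q"
      by (rule standard_for_precedes[OF q assms _ less])
        (use pi qi g in \<open>simp_all only: atLeastAtMost_iff\<close>)
    then obtain j k where jk: "j < k" "k < length q" "q ! j = p ! i" "q ! k = q ! i"
      by (blast dest: precedes_conv_nth)
    then have "k = i" using nth_eq_iff_index_eq[OF q(2), of k i] i len by simp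
    then have "p ! j = p ! i" "j < i" using jk before by simp_all
    then show False using nth_eq_iff_index_eq[OF p(2), of j i] i by simp
  qed
  have len: "length p = length q" using eq map_eq_imp_length_eq by blast
  have "i < length p \<Longrightarrow> p ! i = q ! i" for i
  proof (induction i rule: less_induct)
    case (less i)
    have g: "g (p ! i) = g (q ! i)" using eq less.prems len by (metis nth_map)
    have before: "\<forall>j<i. p ! j = q ! j" using less by simp
    show ?case
    proof (rule linorder_cases[of "p ! i" "q ! i"])
      assume "p ! i < q ! i"
      then show ?thesis
        using first_difference[of p q i] p q len g before less.prems
        by (simp add: permutations_of_set_def)
    next
      assume "q ! i < p ! i"
      then show ?thesis
        using first_difference[of q p i] p q len g before less.prems
        by (simp add: permutations_of_set_def)
    qed
  qed
  then show "p = q" using len by (intro nth_equalityI) auto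
qed

text \<open>Insert the largest letter \<open>n\<close> at the position of the last occurrence of \<open>g n\<close>.\<close>

lemma ex_standard_for:
  assumes "mono_on {1..n} g" "mset u = image_mset g (mset_set {1..n})"
  shows "\<exists>\<pi>. \<pi> \<in> permutations_of_set {1..n} \<and> standard_for g \<pi> \<and> map g \<pi> = u"
  using assms
proof (induction n arbitrary: u)
  case 0
  then show ?case by (simp add: standard_for_def)
next
  case (Suc n)
  have S: "mset_set {1..Suc n} = add_mset (Suc n) (mset_set {1..n})"
    by (simp add: atLeastAtMostSuc_conv)
  have "g (Suc n) \<in># mset u" unfolding Suc.prems(2) S by simp
  then obtain x y where u: "u = x @ g (Suc n) # y" "g (Suc n) \<notin> set y"
    by (auto dest: split_list_last)
  have "mset (x @ y) = image_mset g (mset_set {1..n})"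
    using Suc.prems(2) unfolding S u by simp
  moreover have "mono_on {1..n} g" using Suc.prems(1) by (rule mono_on_subset) auto
  ultimately obtain \<pi> where \<pi>: "\<pi> \<in> permutations_of_set {1..n}" "standard_for g \<pi>" "map g \<pi> = x @ y"
    using Suc.IH by blast
  then obtain p q where pq: "\<pi> = p @ q" "map g p = x" "map g q = y"
    by (auto simp: map_eq_append_conv)
  have set: "set p \<union> set q = {1..n}" "distinct (p @ q)"
    using \<pi>(1) pq by (auto simp: permutations_of_set_def)
  have "k \<notin> set p \<union> set q" if "k > n" for k
    using that unfolding set(1) by simp
  then have notin: "Suc n \<notin> set p" "Suc n \<notin> set q" "Suc (Suc n) \<notin> set p" "Suc (Suc n) \<notin> set q"
    by simp_all
  let ?\<pi> = "p @ Suc n # q"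
  have "?\<pi> \<in> permutations_of_set {1..Suc n}"
    using set notin by (auto simp: permutations_of_set_def atLeastAtMostSuc_conv)
  moreover have "standard_for g ?\<pi>" unfolding standard_for_def
  proof (intro allI impI)
    fix i assume i: "precedes (Suc i) i ?\<pi>"
    \<comment> \<open>The only new pair to check is \<open>Suc n\<close> before \<open>n\<close>.
      Then \<open>n\<close> lies in \<open>q\<close>, so \<open>g n\<close> occurs in
      \<open>y\<close>, which avoids \<open>g (Suc n)\<close>.\<close>
    consider "i = n" "n \<in> set q" | "precedes (Suc i) i (p @ q)"
      using i notin by (auto simp: precedes_append dest: precedes_imp_in_set)
    then show "g i < g (Suc i)"
    proof cases
      case 1
      then have "g n \<in> set y" using pq(3) by auto
      then have "g n \<noteq> g (Suc n)" using u(2) by metis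
      moreover have "g n \<le> g (Suc n)"
        using 1 set by (intro mono_onD[OF Suc.prems(1)]) auto
      ultimately show ?thesis using 1 by simp
    next
      case 2
      then show ?thesis using \<pi>(2) pq by (simp add: standard_for_def)
    qed
  qed
  ultimately show ?case using pq u by (intro exI[of _ ?\<pi>]) auto
qed

lemma bij_betw_standard_for:
  assumes "mono_on {1..n} g"
  shows "bij_betw (map g) {\<pi> \<in> permutations_of_set {1..n}. standard_for g \<pi>}
    (permutations_of_multiset (image_mset g (mset_set {1..n})))"
  unfolding bij_betw_def
proof (intro conjI inj_on_map_standard_for[OF assms] equalityI subsetI)
  fix u assume "u \<in> map g ` {\<pi> \<in> permutations_of_set {1..n}. standard_for g \<pi>}"
  then obtain \<pi> where \<pi>: "\<pi> \<in> permutations_of_set {1..n}" "u = map g \<pi>" by auto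
  have "mset \<pi> = mset_set {1..n}"
    using \<pi>(1) by (metis mset_set_set permutations_of_setD)
  then show "u \<in> permutations_of_multiset (image_mset g (mset_set {1..n}))"
    using \<pi>(2) by (simp add: permutations_of_multiset_def)
next
  fix u assume "u \<in> permutations_of_multiset (image_mset g (mset_set {1..n}))"
  then show "u \<in> map g ` {\<pi> \<in> permutations_of_set {1..n}. standard_for g \<pi>}"
    using ex_standard_for[OF assms, of u] by (auto simp: permutations_of_multiset_def)
qed

section \<open>Words of given content\<close>

lemma des_snoc:
  "des (u @ [x]) = des u + (if u \<noteq> [] \<and> last u > x then 1 else 0)"
proof -
  let ?D = "\<lambda>w. {i. Suc i < length w \<and> w ! i > w ! Suc i}"
  have fin: "finite (?D u)" by (rule finite_subset[of _ "{..<length u}"]) auto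
  have eq: "?D (u @ [x]) = ?D u \<union> (if u \<noteq> [] \<and> last u > x then {length u - 1} else {})"
  proof (cases "u = []")
    case False
    have "i \<in> ?D (u @ [x]) \<longleftrightarrow> i \<in> ?D u \<or> i = length u - 1 \<and> last u > x" for i
    proof (cases "Suc i = length u")
      case True
      then have "i = length u - 1" by simp
      then show ?thesis using False True by (simp add: nth_append last_conv_nth)
    qed (use False in \<open>auto simp: nth_append\<close>)
    then show ?thesis using False by auto
  qed auto
  have "length u - 1 \<notin> ?D u" by auto
  then show ?thesis unfolding des_def eq using fin by simp
qed

lemma des_less_length: "u \<noteq> [] \<Longrightarrow> des u < length u"
proof (induction u rule: rev_induct)
  case (snoc x u)
  then show ?case by (cases "u = []") (auto simp: des_snoc, simp add: des_def)
qed simp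

text \<open>For a natural number \<open>a\<close> this counts the weakly increasing assignments of
  \<open>a\<close> colours to the letters of \<open>u\<close> that increase strictly at each
  descent.\<close>

definition word_weight :: "'a::field_char_0 \<Rightarrow> nat list \<Rightarrow> 'a" where
  "word_weight a u = (a + of_nat (length u) - 1 - of_nat (des u)) gchoose length u"

text \<open>The coefficient of the monomial \<open>m\<close> in the product over all variables of
  \<open>(1 - x) ^ (- a)\<close>. For a natural number \<open>a\<close> it counts the ways to colour
  the letters of \<open>m\<close> with \<open>a\<close> colours, equal letters being
  indistinguishable.\<close>

definition content_weight :: "'a::field_char_0 \<Rightarrow> nat multiset \<Rightarrow> 'a" where
  "content_weight a m = (\<Prod>x\<in>set_mset m. (a + of_nat (count m x) - 1) gchoose count m x)"

lemma sorted_snoc_iff: "sorted (w @ [x]) \<longleftrightarrow> sorted w \<and> (w = [] \<or> last w \<le> x)"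
  by (induction w rule: rev_induct) (force simp: sorted_append)+

text \<open>
  Think of a weakly increasing sequence of \<open>a + 1\<close> colours attached to the letters, strictly
  increasing at descents: the letters carrying the largest colour form a weakly increasing suffix.
\<close>

lemma word_weight_plus_one:
  "word_weight (a + 1) u =
    (\<Sum>k | k \<le> length u \<and> sorted (drop k u). word_weight a (take k u))"
proof (induction u rule: rev_induct)
  case Nil
  have "{k. k \<le> length ([]::nat list) \<and> sorted (drop k ([]::nat list))} = {0}" by auto
  then show ?case by (simp add: word_weight_def)
next
  case (snoc x u)
  let ?S = "\<lambda>w::nat list. {k. k \<le> length w \<and> sorted (drop k w)}"
  have fin: "finite (?S w)" for w by (rule finite_subset[of _ "{..length w}"]) auto
  \<comment> \<open>The last summand is the term \<open>k = Suc (length u)\<close> of the claim. The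
    binomial before it accounts for the rest: it is \<open>word_weight (a + 1) u\<close> if
    \<open>x\<close> creates no descent and \<open>word_weight a u\<close> if it does.\<close>
  have pascal: "word_weight (a + 1) (u @ [x]) =
      ((a + of_nat (length u) - of_nat (des (u @ [x]))) gchoose length u) + word_weight a (u @ [x])"
    using gbinomial_Suc_Suc[of "a + of_nat (length u) - of_nat (des (u @ [x]))" "length u"]
    by (simp add: word_weight_def algebra_simps)
  show ?case
  proof (cases "u = [] \<or> last u \<le> x")
    case True
    have "sorted (drop k (u @ [x])) \<longleftrightarrow> sorted (drop k u)" if "k \<le> length u" for k
      using True that by (cases "k = length u") (auto simp: sorted_snoc_iff)
    then have "?S (u @ [x]) = insert (Suc (length u)) (?S u)"
      by (auto simp: le_Suc_eq)
    moreover have "Suc (length u) \<notin> ?S u" by simp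
    moreover have "(\<Sum>k\<in>?S u. word_weight a (take k (u @ [x]))) = word_weight (a + 1) u"
      unfolding snoc by (intro sum.cong) auto
    moreover have "word_weight (a + 1) u =
        (a + of_nat (length u) - of_nat (des (u @ [x]))) gchoose length u"
      using True by (auto simp: word_weight_def des_snoc)
    ultimately show ?thesis using fin[of u] pascal by (simp add: add.commute)
  next
    case False
    have "\<not> sorted (drop k (u @ [x]))" if "k < length u" for k
      using False that by (auto simp: sorted_snoc_iff)
    then have "?S (u @ [x]) = {length u, Suc (length u)}"
      by (auto simp: le_Suc_eq)
    moreover have "word_weight a u =
        (a + of_nat (length u) - of_nat (des (u @ [x]))) gchoose length u"
      using False by (auto simp: word_weight_def des_snoc algebra_simps)
    ultimately show ?thesis using pascal by (simp add: add.commute)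
  qed
qed

lemma finite_submultisets: "finite {k. k \<subseteq># (m::'a multiset)}"
proof -
  have "{k. k \<subseteq># m} \<subseteq> mset ` {w. set w \<subseteq> set_mset m \<and> length w \<le> size m}"
  proof
    fix k assume k: "k \<in> {k. k \<subseteq># m}"
    obtain w where "mset w = k" using ex_mset by blast
    then show "k \<in> mset ` {w. set w \<subseteq> set_mset m \<and> length w \<le> size m}"
      using k by (intro image_eqI[of _ _ w]) (auto dest: mset_subset_eqD size_mset_mono)
  qed
  then show ?thesis by (rule finite_subset) (simp add: finite_lists_length_le)
qed

text \<open>A word cut in front of a sorted suffix is determined by its prefix, since the suffix
  must be the sorted list of the remaining letters. The prefix can be any word with content
  \<open>k\<close> below \<open>m\<close>.\<close>

lemma sum_splits_sorted_suffix:
  fixes f :: "nat list \<Rightarrow> 'b::comm_monoid_add"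
  shows "(\<Sum>u\<in>permutations_of_multiset m. \<Sum>k | k \<le> length u \<and> sorted (drop k u). f (take k u)) =
    (\<Sum>k | k \<subseteq># m. \<Sum>v\<in>permutations_of_multiset k. f v)"
proof -
  have fin: "finite {k. k \<le> length w \<and> sorted (drop k w)}" for w :: "nat list"
    by (rule finite_subset[of _ "{..length w}"]) auto
  show ?thesis
    unfolding sum.Sigma[OF finite_permutations_of_multiset ballI[OF fin]]
      sum.Sigma[OF finite_submultisets ballI[OF finite_permutations_of_multiset]]
  proof (rule sum.reindex_bij_witness[where
        i = "\<lambda>(k, v). (v @ sorted_list_of_multiset (m - k), length v)" and
        j = "\<lambda>(u, k). (mset (take k u), take k u)"], goal_cases)
    case (1 p)
    obtain u k where p: "p = (u, k)" by (cases p)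
    with 1 have u: "mset u = m" "k \<le> length u" "sorted (drop k u)"
      by (auto simp: permutations_of_multiset_def)
    have "mset u = mset (take k u) + mset (drop k u)"
      by (metis append_take_drop_id mset_append)
    then have "m - mset (take k u) = mset (drop k u)" using u by simp
    then have "sorted_list_of_multiset (m - mset (take k u)) = drop k u"
      using u(3) by (simp add: sorted_sort_id)
    then show ?case using p u by simp
  next
    case (2 p)
    obtain u k where p: "p = (u, k)" by (cases p)
    with 2 show ?case
      by (auto simp: permutations_of_multiset_def) (metis append_take_drop_id mset_append mset_subset_eq_add_left)
  next
    case (4 p)
    then show ?case
      by (auto simp: permutations_of_multiset_def)
  qed (auto simp: permutations_of_multiset_def)
qed

lemma content_weight_superset:
  assumes "finite A" "set_mset m \<subseteq> A"
  shows "content_weight a m = (\<Prod>x\<in>A. (a + of_nat (count m x) - 1) gchoose count m x)"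
  unfolding content_weight_def
proof (rule prod.mono_neutral_left[OF assms], intro ballI)
  fix x assume "x \<in> A - set_mset m"
  then have "count m x = 0" by (simp add: count_eq_zero_iff)
  then show "(a + of_nat (count m x) - 1) gchoose count m x = 1" by simp
qed

text \<open>Each factor on the left is a parallel sum of binomials with parameter \<open>a\<close>.
  Expanding the product chooses a multiplicity for every letter of \<open>m\<close>, that is, a
  submultiset.\<close>

lemma content_weight_plus_one:
  "content_weight (a + 1) m = (\<Sum>k | k \<subseteq># m. content_weight a k)"
proof -
  let ?A = "set_mset m"
  let ?g = "\<lambda>j. (a + of_nat j - 1) gchoose j"
  let ?j = "\<lambda>h. \<Sum>x\<in>?A. replicate_mset (h x) x"
  have c: "count (?j h) y = (if y \<in> ?A then h y else 0)" for h y
    by (simp add: count_sum)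
  have "content_weight (a + 1) m = (\<Prod>x\<in>?A. \<Sum>j\<in>{..count m x}. ?g j)"
    unfolding content_weight_def
  proof (rule prod.cong)
    fix x
    show "(a + 1 + of_nat (count m x) - 1) gchoose count m x = (\<Sum>j\<le>count m x. ?g j)"
      using gbinomial_parallel_sum[of "a - 1" "count m x"] by (simp add: algebra_simps)
  qed simp
  also have "\<dots> = (\<Sum>h\<in>(\<Pi>\<^sub>E x\<in>?A. {..count m x}). \<Prod>x\<in>?A. ?g (h x))"
    by (rule prod_sum_PiE) auto
  also have "\<dots> = (\<Sum>k | k \<subseteq># m. content_weight a k)"
  proof (rule sum.reindex_bij_witness[where
        i = "\<lambda>k. restrict (count k) ?A" and j = ?j], goal_cases)
    case (1 h)
    then have "h y = undefined" if "y \<notin> ?A" for y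
      using that by (rule PiE_arb)
    then show ?case by (intro ext) (simp add: c restrict_def)
  next
    case (2 h)
    then show ?case by (auto simp: subseteq_mset_def c PiE_def)
  next
    case (3 k)
    then have "count k y = 0" if "y \<notin># m" for y
      using that by (auto dest: mset_subset_eqD simp: count_eq_zero_iff)
    then show ?case by (intro multiset_eqI) (auto simp: c)
  next
    case (4 k)
    then show ?case by (auto simp: subseteq_mset_def)
  next
    case (5 h)
    have "set_mset (?j h) \<subseteq> ?A"
      by (auto simp: c simp flip: count_greater_zero_iff split: if_splits)
    then have "content_weight a (?j h) = (\<Prod>x\<in>?A. ?g (count (?j h) x))"
      by (intro content_weight_superset) simp
    then show ?case by (simp add: c)
  qed
  finally show ?thesis .
qed

text \<open>Since \<open>des u < length u\<close>, the upper entry of the binomial is a natural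
  number smaller than the lower entry.\<close>

lemma word_weight_zero: "word_weight 0 u = (if u = [] then 1 else 0)"
proof (cases "u = []")
  case False
  have "word_weight 0 u = (of_nat (length u - Suc (des u)) :: 'a) gchoose length u"
    using des_less_length[OF False] by (simp add: word_weight_def of_nat_diff diff_diff_eq)
  then show ?thesis
    using False by (simp add: binomial_gbinomial[symmetric] binomial_eq_0)
qed (simp add: word_weight_def)

lemma content_weight_zero: "content_weight 0 m = (if m = {#} then 1 else 0)"
proof (cases "m = {#}")
  case False
  then obtain x where x: "x \<in># m" by blast
  then obtain c where "count m x = Suc c"
    by (cases "count m x") (simp_all add: count_eq_zero_iff)
  then have "(0 + of_nat (count m x) - 1 :: 'a) gchoose count m x = 0"
    by (simp add: binomial_gbinomial[symmetric] binomial_eq_0)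
  then show ?thesis using x unfolding content_weight_def by (auto intro: prod_zero)
qed (simp add: content_weight_def)

text \<open>The common recursion passes from \<open>m\<close> to its submultisets, so
  \<open>m\<close> varies in the induction on \<open>N\<close>.\<close>

lemma sum_word_weight_of_nat:
  "(\<Sum>u\<in>permutations_of_multiset m. word_weight (of_nat N :: 'a::field_char_0) u) =
    content_weight (of_nat N) m"
proof (induction N arbitrary: m)
  case 0
  show ?case
  proof (cases "m = {#}")
    case False
    then have "(\<Sum>u\<in>permutations_of_multiset m. word_weight (0::'a) u) = 0"
      by (intro sum.neutral) (auto simp: word_weight_zero permutations_of_multiset_def)
    then show ?thesis using False by (simp add: content_weight_zero)
  qed (simp add: word_weight_zero content_weight_zero)
next
  case (Suc N)
  have "(\<Sum>u\<in>permutations_of_multiset m. word_weight (of_nat N + 1 :: 'a) u) =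
      (\<Sum>k | k \<subseteq># m. \<Sum>v\<in>permutations_of_multiset k. word_weight (of_nat N) v)"
    unfolding word_weight_plus_one sum_splits_sorted_suffix ..
  also have "\<dots> = content_weight (of_nat N + 1) m"
    unfolding Suc.IH content_weight_plus_one ..
  finally show ?case unfolding of_nat_Suc by (simp only: add.commute)
qed

section \<open>Identities in the parameter from their natural values\<close>

definition polyfun :: "('a::comm_ring_1 \<Rightarrow> 'a) \<Rightarrow> bool" where
  "polyfun f \<longleftrightarrow> (\<exists>P. f = poly P)"

lemma polyfun_prod:
  assumes "\<And>x. x \<in> A \<Longrightarrow> polyfun (f x)"
  shows "polyfun (\<lambda>a. \<Prod>x\<in>A. f x a)"
proof -
  obtain P where "f x = poly (P x)" if "x \<in> A" for x
    using assms unfolding polyfun_def by metis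
  then have "(\<lambda>a. \<Prod>x\<in>A. f x a) = poly (\<Prod>x\<in>A. P x)"
    by (auto simp: fun_eq_iff poly_prod intro!: prod.cong)
  then show ?thesis by (auto simp: polyfun_def)
qed

lemma polyfun_sum:
  assumes "\<And>x. x \<in> A \<Longrightarrow> polyfun (f x)"
  shows "polyfun (\<lambda>a. \<Sum>x\<in>A. f x a)"
proof -
  obtain P where "f x = poly (P x)" if "x \<in> A" for x
    using assms unfolding polyfun_def by metis
  then have "(\<lambda>a. \<Sum>x\<in>A. f x a) = poly (\<Sum>x\<in>A. P x)"
    by (auto simp: fun_eq_iff poly_sum intro!: sum.cong)
  then show ?thesis by (auto simp: polyfun_def)
qed

text \<open>The form \<open>a + b - c\<close> fits the upper entries in both
  \<open>word_weight\<close> and \<open>content_weight\<close>.\<close>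

lemma polyfun_gchoose:
  "polyfun (\<lambda>a::'a::field_char_0. (a + b - c) gchoose n)"
proof -
  have "(\<lambda>a. (a + b - c) gchoose n) =
      poly (smult (inverse (fact n)) (\<Prod>i=0..<n. [:b - c - of_nat i, 1:]))"
    by (auto simp: fun_eq_iff gbinomial_prod_rev poly_prod field_simps intro!: prod.cong)
  then show ?thesis by (auto simp: polyfun_def)
qed

text \<open>A nonzero polynomial has finitely many roots. This carries the identity from natural
  numbers to every element of the field, \<open>alpha\<close> included.\<close>

lemma polyfun_eqI:
  fixes f g :: "'a::field_char_0 \<Rightarrow> 'a"
  assumes "polyfun f" "polyfun g" "\<And>N. f (of_nat N) = g (of_nat N)"
  shows "f = g"
proof -
  obtain P Q where PQ: "f = poly P" "g = poly Q" using assms by (auto simp: polyfun_def)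
  have "range of_nat \<subseteq> {x. poly (P - Q) x = 0}" using assms(3) PQ by auto
  moreover have "infinite (range (of_nat :: nat \<Rightarrow> 'a))"
    by (simp add: finite_image_iff inj_of_nat)
  ultimately have "infinite {x. poly (P - Q) x = 0}" using finite_subset by blast
  then have "P - Q = 0" using poly_roots_finite by blast
  then show ?thesis using PQ by simp
qed

lemma sum_word_weight:
  "(\<Sum>u\<in>permutations_of_multiset m. word_weight a u) = content_weight a m"
proof -
  have w: "polyfun (\<lambda>a. word_weight a u)" for u
    using polyfun_gchoose[of "of_nat (length u)" "1 + of_nat (des u)" "length u"]
    by (simp add: word_weight_def diff_diff_eq)
  have c: "polyfun (\<lambda>a. content_weight a m)"
    unfolding content_weight_def by (intro polyfun_prod polyfun_gchoose)
  show ?thesis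
    using polyfun_eqI[OF polyfun_sum[OF w] c sum_word_weight_of_nat] by (rule fun_cong)
qed

section \<open>Coefficients of the quasisymmetric sum\<close>

lemma fundamental_qsym_eq:
  "fundamental_qsym n \<sigma> m =
    (if size m = n \<and> (\<forall>j\<in>\<sigma>. sorted_list_of_multiset m ! (j - 1) < sorted_list_of_multiset m ! j)
     then 1 else 0)"
proof -
  let ?w = "sorted_list_of_multiset m"
  \<comment> \<open>There is exactly one sorted word with content \<open>m\<close>, so every
    coefficient is 0 or 1.\<close>
  have "{w \<in> {w. length w = n \<and> sorted w \<and> (\<forall>j\<in>\<sigma>. w ! (j - 1) < w ! j)}. mset w = m} =
      (if size m = n \<and> (\<forall>j\<in>\<sigma>. ?w ! (j - 1) < ?w ! j) then {?w} else {})"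
    (is "?L = ?R")
  proof (intro set_eqI)
    fix w
    have "sorted w \<and> mset w = m \<longleftrightarrow> w = ?w"
      by (metis mset_sorted_list_of_multiset sorted_list_of_multiset_mset sorted_sort sorted_sort_id)
    moreover have "length ?w = size m"
      by (metis mset_sorted_list_of_multiset size_mset)
    ultimately show "w \<in> ?L \<longleftrightarrow> w \<in> ?R" by (cases "w = ?w") auto
  qed
  then show ?thesis unfolding fundamental_qsym_def word_series_def by simp
qed

lemma sum_gchoose_fundamental_qsym:
  fixes a :: "'a::field_char_0"
  shows "(\<Sum>\<pi>\<in>permutations_of_set {1..n}.
      ((a + of_nat n - 1 - of_nat (des \<pi>)) gchoose n) *
      fundamental_qsym n (Des (insertion_tableau \<pi>)) m) =
    (if size m = n then content_weight a m else 0)"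
proof (cases "size m = n")
  case False
  then show ?thesis by (simp add: fundamental_qsym_eq)
next
  case True
  let ?w = "sorted_list_of_multiset m"
  \<comment> \<open>\<open>g k\<close> is the \<open>k\<close>-th letter, counted from 1, of the
    sorted word with content \<open>m\<close>. The strictness required at a descent \<open>j\<close>
    then reads \<open>g j < g (Suc j)\<close>, so the quasisymmetric coefficient tests
    \<open>standard_for g\<close>.\<close>
  define g where "g k = ?w ! (k - 1)" for k
  have len: "length ?w = n" using True by (metis mset_sorted_list_of_multiset size_mset)
  have mono: "mono_on {1..n} g"
  proof (rule mono_onI)
    fix r s assume "r \<in> {1..n}" "s \<in> {1..n}" "r \<le> s"
    then show "g r \<le> g s" unfolding g_def by (intro sorted_nth_mono) (auto simp: len)
  qed
  have content: "image_mset g (mset_set {1..n}) = m"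
  proof -
    have "map g [1..<Suc n] = ?w"
      by (rule nth_equalityI) (simp_all add: len g_def del: upt_Suc)
    then have "mset (map g [1..<Suc n]) = m" by simp
    moreover have "{Suc 0..<Suc n} = {1..n}" by auto
    ultimately show ?thesis by (simp del: upt_Suc)
  qed
  let ?S = "{\<pi> \<in> permutations_of_set {1..n}. standard_for g \<pi>}"
  let ?weight = "\<lambda>\<pi>. (a + of_nat n - 1 - of_nat (des \<pi>)) gchoose n"
  have qsym: "fundamental_qsym n (Des (insertion_tableau \<pi>)) m = (if standard_for g \<pi> then 1 else 0 :: 'a)"
    if "\<pi> \<in> permutations_of_set {1..n}" for \<pi>
  proof -
    have "distinct \<pi>" using that by (simp add: permutations_of_set_def)
    then show ?thesis
      unfolding fundamental_qsym_eq standard_for_def Ball_def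
        Des_insertion_tableau[OF \<open>distinct \<pi>\<close>] g_def
      using True by simp
  qed
  have "(\<Sum>\<pi>\<in>permutations_of_set {1..n}.
      ?weight \<pi> * fundamental_qsym n (Des (insertion_tableau \<pi>)) m) = (\<Sum>\<pi>\<in>?S. ?weight \<pi>)"
    by (rule sum.mono_neutral_cong_right) (auto simp: qsym)
  also have "\<dots> = (\<Sum>\<pi>\<in>?S. word_weight a (map g \<pi>))"
  proof (rule sum.cong)
    fix \<pi> assume "\<pi> \<in> ?S"
    then have \<pi>: "standard_for g \<pi>" "distinct \<pi>" "set \<pi> = {1..n}"
      by (simp_all add: permutations_of_set_def)
    then have "length \<pi> = n" using distinct_card[of \<pi>] by simp
    then show "?weight \<pi> = word_weight a (map g \<pi>)"
      using des_map_standard_for[OF \<pi> mono] by (simp add: word_weight_def)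
  qed simp
  also have "\<dots> = (\<Sum>u\<in>permutations_of_multiset m. word_weight a u)"
    using sum.reindex_bij_betw[OF bij_betw_standard_for[OF mono]] unfolding content .
  finally show ?thesis using True by (simp add: sum_word_weight)
qed

section \<open>Exponents of monomials\<close>

text \<open>The exponents of a monomial; as a multiset they classify monomials up to a permutation
  of the variables.\<close>

definition shape :: "nat multiset \<Rightarrow> nat multiset" where
  "shape m = image_mset (count m) (mset_set (set_mset m))"

lemma sum_mset_shape: "sum_mset (shape m) = size m"
  by (simp add: shape_def size_multiset_overloaded_eq sum_unfold_sum_mset)

lemma size_shape: "size (shape m) = card (set_mset m)"
  by (simp add: shape_def)

lemma shape_empty [simp]: "shape {#} = {#}"
  by (simp add: shape_def)

lemma zero_notin_shape: "0 \<notin># shape m"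
  by (auto simp: shape_def count_eq_zero_iff)

lemma shape_add_replicate:
  assumes "i \<notin># m" "k > 0"
  shows "shape (m + replicate_mset k i) = add_mset k (shape m)"
proof -
  have S: "set_mset (m + replicate_mset k i) = insert i (set_mset m)" using assms by auto
  have "image_mset (count (m + replicate_mset k i)) (mset_set (set_mset m)) =
      image_mset (count m) (mset_set (set_mset m))"
    by (rule image_mset_cong) (use assms in auto)
  then show ?thesis
    unfolding shape_def S using assms by (simp add: count_eq_zero_iff)
qed

lemma ex_shape: "0 \<notin># M \<Longrightarrow> \<exists>m. shape m = M"
proof (induction M)
  case empty
  show ?case by (rule exI[of _ "{#}"]) simp
next
  case (add k M)
  then obtain m where m: "shape m = M" by auto
  obtain i where "i \<notin># m" using ex_new_if_finite[OF infinite_UNIV_nat finite_set_mset] by blast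
  then show ?case using shape_add_replicate[of i m k] m add.prems by auto
qed

lemma count_image_mset_inj: "inj h \<Longrightarrow> count (image_mset h m) (h x) = count m x"
  by (induction m) (auto dest: injD)

text \<open>Symmetry is stated for bijections of all indices, so a matching of supports has to be
  extended. The sets \<open>B - A\<close> and \<open>A - B\<close> have the same size and can be
  matched; everything outside \<open>A \<union> B\<close> stays fixed.\<close>

lemma bij_extends_bij_betw_finite:
  fixes A B :: "'a set"
  assumes "finite A" "finite B" "bij_betw h A B"
  obtains \<pi> where "bij \<pi>" "\<And>x. x \<in> A \<Longrightarrow> \<pi> x = h x"
proof -
  have "card (B - A) = card (A - B)"
    using bij_betw_same_card[OF assms(3)] assms(1,2)
    by (metis add_diff_cancel_left' card_Diff_subset_Int card_Int_Diff finite_Int inf_commute)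
  then obtain h' where h': "bij_betw h' (B - A) (A - B)"
    using finite_same_card_bij[of "B - A" "A - B"] assms by auto
  define \<pi> where "\<pi> x = (if x \<in> A then h x else if x \<in> B - A then h' x else x)" for x
  have "bij_betw \<pi> A B" using assms(3) by (rule bij_betw_cong[THEN iffD1, rotated]) (simp add: \<pi>_def)
  moreover have "bij_betw \<pi> (B - A) (A - B)"
    using h' by (rule bij_betw_cong[THEN iffD1, rotated]) (simp add: \<pi>_def)
  ultimately have 1: "bij_betw \<pi> (A \<union> (B - A)) (B \<union> (A - B))"
    by (rule bij_betw_combine) blast
  have 2: "bij_betw \<pi> (- (A \<union> B)) (- (A \<union> B))"
    by (rule bij_betw_cong[THEN iffD1, OF _ bij_betw_id]) (simp add: \<pi>_def)
  have "bij_betw \<pi> ((A \<union> (B - A)) \<union> - (A \<union> B)) ((B \<union> (A - B)) \<union> - (A \<union> B))"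
    using 1 2 by (rule bij_betw_combine) blast
  moreover have "(A \<union> (B - A)) \<union> - (A \<union> B) = UNIV" "(B \<union> (A - B)) \<union> - (A \<union> B) = UNIV" by auto
  ultimately have "bij \<pi>" by simp
  then show thesis by (rule that) (simp add: \<pi>_def)
qed

text \<open>An arbitrary bijection \<open>h\<close> of the supports need not respect exponents.
  Precomposing it with a permutation \<open>p\<close> of the first support repairs this, and the
  result extends to all variables.\<close>

lemma shape_eq_imp_bij:
  assumes "shape m = shape m'"
  obtains \<pi> where "bij \<pi>" "image_mset \<pi> m = m'"
proof -
  let ?A = "set_mset m" and ?B = "set_mset m'"
  have "card ?A = card ?B" using assms size_shape by metis
  then obtain h where h: "bij_betw h ?A ?B"
    using finite_same_card_bij[OF finite_set_mset finite_set_mset] by blast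
  have "mset_set ?B = image_mset h (mset_set ?A)"
    using h by (simp add: bij_betw_def image_mset_mset_set)
  then have "image_mset (count m) (mset_set ?A) = image_mset (count m' \<circ> h) (mset_set ?A)"
    using assms by (simp add: shape_def image_mset.compositionality)
  then obtain p where p: "p permutes ?A" "\<forall>x\<in>?A. count m x = (count m' \<circ> h) (p x)"
    using image_mset_eq_implies_permutes[of ?A "count m" "count m' \<circ> h"] by auto
  have hp: "bij_betw (h \<circ> p) ?A ?B"
    using permutes_imp_bij[OF p(1)] h by (rule bij_betw_trans)
  then obtain \<pi> where \<pi>: "bij \<pi>" "\<And>x. x \<in> ?A \<Longrightarrow> \<pi> x = (h \<circ> p) x"
    using bij_extends_bij_betw_finite[OF finite_set_mset finite_set_mset] by blast
  have count: "count (image_mset \<pi> m) (\<pi> x) = count m' (\<pi> x)" for x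
  proof (cases "x \<in># m")
    case True
    then have "count m x = count m' (\<pi> x)" using p(2) \<pi>(2) by simp
    then show ?thesis using count_image_mset_inj[OF bij_is_inj[OF \<pi>(1)]] by simp
  next
    case False
    have "\<pi> x \<notin># m'"
    proof
      assume "\<pi> x \<in># m'"
      then have "\<pi> x \<in> (h \<circ> p) ` ?A" using hp by (simp only: bij_betw_imp_surj_on)
      then obtain y where "y \<in># m" "\<pi> x = \<pi> y" using \<pi>(2) by auto
      then show False using False \<pi>(1) by (metis bij_is_inj injD)
    qed
    then show ?thesis
      using False \<pi>(1) by (simp add: count_image_mset_inj bij_is_inj count_eq_zero_iff[symmetric])
  qed
  have "image_mset \<pi> m = m'"
  proof (rule multiset_eqI)
    fix y
    obtain x where "y = \<pi> x" using \<pi>(1) by (metis bij_pointE)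
    then show "count (image_mset \<pi> m) y = count m' y" by (simp only: count)
  qed
  then show thesis using \<pi>(1) that by blast
qed

section \<open>Partitions as sorted lists of multisets\<close>

definition partition_of :: "nat multiset \<Rightarrow> nat list" where
  "partition_of M = rev (sorted_list_of_multiset M)"

lemma mset_partition_of [simp]: "mset (partition_of M) = M"
  by (simp add: partition_of_def)

lemma is_partition_partition_of: "0 \<notin># M \<Longrightarrow> is_partition (partition_of M)"
  by (simp add: is_partition_def partition_of_def sorted_wrt_rev)

lemma partition_of_mset: "is_partition lam \<Longrightarrow> partition_of (mset lam) = lam"
  unfolding is_partition_def partition_of_def sorted_list_of_multiset_mset
  by (metis mset_rev properties_for_sort rev_rev_ident sorted_wrt_rev)

lemma partition_eqI: "is_partition lam \<Longrightarrow> is_partition mu \<Longrightarrow> mset lam = mset mu \<Longrightarrow> lam = mu"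
  by (metis partition_of_mset)

definition partitions_of :: "nat \<Rightarrow> nat list set" where
  "partitions_of n = {lam. is_partition lam \<and> sum_list lam = n}"

lemma length_le_sum_list: "0 \<notin> set lam \<Longrightarrow> length lam \<le> sum_list (lam :: nat list)"
  by (induction lam) auto

lemma finite_partitions_le: "finite {lam. is_partition lam \<and> sum_list lam \<le> d}"
proof (rule finite_subset)
  show "{lam. is_partition lam \<and> sum_list lam \<le> d} \<subseteq> {lam. set lam \<subseteq> {..d} \<and> length lam \<le> d}"
  proof
    fix lam assume "lam \<in> {lam. is_partition lam \<and> sum_list lam \<le> d}"
    then have "0 \<notin> set lam" "sum_list lam \<le> d" by (auto simp: is_partition_def)
    moreover from this have "length lam \<le> d" using length_le_sum_list[of lam] by linarith
    moreover have "x \<le> d" if "x \<in> set lam" for x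
      using member_le_sum_list[OF that] \<open>sum_list lam \<le> d\<close> by linarith
    ultimately show "lam \<in> {lam. set lam \<subseteq> {..d} \<and> length lam \<le> d}" by auto
  qed
qed (simp add: finite_lists_length_le)

lemma finite_partitions_of [simp]: "finite (partitions_of n)"
  by (rule finite_subset[OF _ finite_partitions_le[of n]]) (auto simp: partitions_of_def)

text \<open>The choice does not matter for symmetric series: evaluating one at this monomial reads
  off its coefficient at \<open>monomial_sym lam\<close>.\<close>

definition canonical_monomial :: "nat list \<Rightarrow> nat multiset" where
  "canonical_monomial lam = (SOME m. shape m = mset lam)"

lemma shape_canonical_monomial: "0 \<notin> set lam \<Longrightarrow> shape (canonical_monomial lam) = mset lam"
  unfolding canonical_monomial_def by (rule someI_ex, rule ex_shape) simp

section \<open>Products of power sums\<close>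

text \<open>Multiplication by the power sum of degree \<open>k\<close>, written on coefficients. For
  \<open>k = 0\<close> the index set is infinite and the sum is 0 by convention, so the link to
  \<open>ms_mult\<close> needs \<open>k > 0\<close>.\<close>

definition shift :: "nat \<Rightarrow> 'k::comm_ring_1 mseries \<Rightarrow> 'k mseries" where
  "shift k f m = (\<Sum>i | replicate_mset k i \<subseteq># m. f (m - replicate_mset k i))"

lemma finite_shift_index:
  assumes "k > 0"
  shows "finite {i. replicate_mset k i \<subseteq># m}"
proof (rule finite_subset)
  show "{i. replicate_mset k i \<subseteq># m} \<subseteq> set_mset m"
    using assms by (auto dest!: set_mset_mono)
qed simp

lemma power_sum_eq:
  assumes "k > 0"
  shows "power_sum k a = (if a \<in> range (replicate_mset k) then 1 else 0)"
proof (cases "a \<in> range (replicate_mset k)")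
  case True
  then obtain i where a: "a = replicate_mset k i" by blast
  have "{w \<in> {replicate k i | i. True}. mset w = a} = {replicate k i}"
  proof -
    have "replicate k j = replicate k i" if "replicate_mset k j = replicate_mset k i" for j
      using arg_cong[OF that, of set_mset] assms by simp
    then show ?thesis unfolding a by auto
  qed
  then show ?thesis using True by (simp add: power_sum_def word_series_def)
next
  case False
  then have "{w \<in> {replicate k i | i. True}. mset w = a} = {}" by auto
  then show ?thesis using False by (simp add: power_sum_def word_series_def del: Collect_empty_eq)
qed

lemma ms_mult_power_sum:
  fixes f :: "'k::comm_ring_1 mseries"
  assumes "k > 0"
  shows "ms_mult (power_sum k) f = shift k f"
proof
  fix m :: "nat multiset"
  let ?P = "{(a, b). a + b = m}"
  let ?I = "{i. replicate_mset k i \<subseteq># m}"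
  have fin: "finite ?P"
    by (rule finite_subset[OF _ finite_cartesian_product[OF finite_submultisets finite_submultisets, of m m]])
      auto
  have inj: "inj_on (\<lambda>i. (replicate_mset k i, m - replicate_mset k i)) ?I"
  proof (rule inj_onI)
    fix i j assume "(replicate_mset k i, m - replicate_mset k i) = (replicate_mset k j, m - replicate_mset k j)"
    then have "set_mset (replicate_mset k i) = set_mset (replicate_mset k j)" by simp
    then show "i = j" using assms by simp
  qed
  have "ms_mult (power_sum k) f m = (\<Sum>(a, b)\<in>?P. power_sum k a * f b)"
    by (simp add: ms_mult_def)
  also have "\<dots> = (\<Sum>(a, b)\<in>(\<lambda>i. (replicate_mset k i, m - replicate_mset k i)) ` ?I. f b)"
  proof (rule sum.mono_neutral_cong_right[OF fin], goal_cases)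
    case 1
    show ?case by auto
  next
    case 2
    have "power_sum k a = (0 :: 'k)" if "a + b = m" "(a, b) \<notin> (\<lambda>i. (replicate_mset k i, m - replicate_mset k i)) ` ?I" for a b
    proof -
      have "a \<notin> range (replicate_mset k)" using that by (auto simp: image_iff)
      then show ?thesis by (simp add: power_sum_eq[OF assms])
    qed
    then show ?case by auto
  next
    case (3 p)
    then show ?case using assms by (auto simp: power_sum_eq)
  qed
  also have "\<dots> = shift k f m"
    by (simp add: sum.reindex[OF inj] shift_def)
  finally show "ms_mult (power_sum k) f m = shift k f m" .
qed

lemma power_sum_part_Nil: "power_sum_part [] = ms_one"
  by (simp add: power_sum_part_def)

lemma power_sum_part_Cons:
  "k > 0 \<Longrightarrow> power_sum_part (k # lam) = shift k (power_sum_part lam)"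
  by (simp add: power_sum_part_def ms_mult_power_sum)

text \<open>Either order sums over the pairs \<open>(i, j)\<close> for which the product of the
  \<open>k\<close>-th power of variable \<open>i\<close> and the \<open>l\<close>-th power of
  variable \<open>j\<close> divides the monomial.\<close>

lemma shift_commute:
  assumes "k > 0" "l > 0"
  shows "shift k (shift l f) = shift l (shift k f)"
proof
  fix m :: "nat multiset"
  have shift2: "shift k (shift l f) m =
      (\<Sum>(i, j) | replicate_mset k i + replicate_mset l j \<subseteq># m.
        f (m - (replicate_mset k i + replicate_mset l j)))"
    if "k > 0" "l > 0" for k l
  proof -
    have "replicate_mset k i \<subseteq># m \<and> replicate_mset l j \<subseteq># m - replicate_mset k i \<longleftrightarrow>
        replicate_mset k i + replicate_mset l j \<subseteq># m" for i j
    proof -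
      have "replicate_mset k i + replicate_mset l j \<subseteq># m \<Longrightarrow> replicate_mset k i \<subseteq># m"
        using mset_subset_eq_add_left by (rule subset_mset.order_trans)
      then show ?thesis
        using subset_mset.le_diff_conv2[of "replicate_mset k i" m "replicate_mset l j"]
        by (auto simp only: add.commute[of "replicate_mset l j"])
    qed
    then have "(SIGMA i:{i. replicate_mset k i \<subseteq># m}. {j. replicate_mset l j \<subseteq># m - replicate_mset k i}) =
        {(i, j). replicate_mset k i + replicate_mset l j \<subseteq># m}"
      by auto
    then show ?thesis
      unfolding shift_def
      by (subst sum.Sigma) (use that in \<open>auto simp: finite_shift_index case_prod_unfold\<close>)
  qed
  show "shift k (shift l f) m = shift l (shift k f) m"
    unfolding shift2[OF assms] shift2[OF assms(2,1)]
    by (rule sum.reindex_bij_witness[where i = prod.swap and j = prod.swap]) (auto simp: add.commute)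
qed

text \<open>Newton's recursion takes out a part from any place in the list;
  \<open>shift_commute\<close> brings it to the front.\<close>

lemma power_sum_part_remove1:
  assumes "0 \<notin> set lam" "k \<in> set lam"
  shows "(power_sum_part lam :: 'k::comm_ring_1 mseries) =
    shift k (power_sum_part (remove1 k lam))"
  using assms
proof (induction lam)
  case (Cons l lam)
  then have pos: "l > 0" "k > 0" by (auto intro: gr0I)
  show ?case
  proof (cases "l = k")
    case False
    then have "(power_sum_part lam :: 'k mseries) = shift k (power_sum_part (remove1 k lam))"
      using Cons by simp
    then show ?thesis
      using False pos by (simp add: power_sum_part_Cons shift_commute)
  qed (use pos in \<open>simp add: power_sum_part_Cons\<close>)
qed simp

lemma power_sum_part_eq_0:
  "0 \<notin> set lam \<Longrightarrow> size m \<noteq> sum_list lam \<Longrightarrow> power_sum_part lam m = (0 :: 'k::comm_ring_1)"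
proof (induction lam arbitrary: m)
  case (Cons k lam)
  have "power_sum_part lam (m - replicate_mset k i) = (0 :: 'k)" if "replicate_mset k i \<subseteq># m" for i
    using Cons.prems size_mset_mono[OF that] that
    by (intro Cons.IH) (auto simp: size_Diff_submset)
  then show ?case using Cons.prems by (simp add: power_sum_part_Cons shift_def)
qed (auto simp: power_sum_part_Nil ms_one_def)

lemma power_sum_part_image_mset:
  assumes "bij \<pi>"
  shows "0 \<notin> set lam \<Longrightarrow>
    (power_sum_part lam (image_mset \<pi> m) :: 'k::comm_ring_1) = power_sum_part lam m"
proof (induction lam arbitrary: m)
  case Nil
  then show ?case by (simp add: power_sum_part_Nil ms_one_def)
next
  case (Cons k lam)
  have inj: "inj \<pi>" and surj: "surj \<pi>" using assms by (auto simp: bij_def)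
  have sub: "replicate_mset k (\<pi> i) \<subseteq># image_mset \<pi> m \<longleftrightarrow> replicate_mset k i \<subseteq># m" for i
    unfolding count_le_replicate_mset_subset_eq[symmetric] count_image_mset_inj[OF inj] ..
  have "bij_betw \<pi> {i. replicate_mset k i \<subseteq># m} {i. replicate_mset k i \<subseteq># image_mset \<pi> m}"
  proof (rule bij_betw_imageI[OF inj_on_subset[OF inj subset_UNIV]], intro equalityI subsetI)
    fix j assume j: "j \<in> {i. replicate_mset k i \<subseteq># image_mset \<pi> m}"
    obtain i where "j = \<pi> i" using surj by (auto simp: surj_def)
    then show "j \<in> \<pi> ` {i. replicate_mset k i \<subseteq># m}" using j sub by auto
  qed (auto simp: sub)
  then have "(shift k (power_sum_part lam) (image_mset \<pi> m) :: 'k) =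
      (\<Sum>i | replicate_mset k i \<subseteq># m.
        power_sum_part lam (image_mset \<pi> m - replicate_mset k (\<pi> i)))"
    unfolding shift_def by (rule sum.reindex_bij_betw[symmetric])
  also have "\<dots> = shift k (power_sum_part lam) m"
    unfolding shift_def
  proof (rule sum.cong)
    fix i assume "i \<in> {i. replicate_mset k i \<subseteq># m}"
    then have "image_mset \<pi> m - replicate_mset k (\<pi> i) = image_mset \<pi> (m - replicate_mset k i)"
      by (simp add: image_mset_Diff)
    then show "power_sum_part lam (image_mset \<pi> m - replicate_mset k (\<pi> i)) =
        (power_sum_part lam (m - replicate_mset k i) :: 'k)"
      using Cons by simp
  qed simp
  finally show ?case using Cons.prems by (simp add: power_sum_part_Cons)
qed

lemma power_sum_part_nonneg:
  "0 \<notin> set lam \<Longrightarrow> (power_sum_part lam m :: 'k::linordered_field) \<ge> 0"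
  by (induction lam arbitrary: m)
    (auto simp: power_sum_part_Nil ms_one_def power_sum_part_Cons shift_def intro!: sum_nonneg)

text \<open>The diagonal entry of the triangularity below. Some variable carries the exponent
  \<open>k\<close>; removing it gives a positive term by induction, and all other terms are
  nonnegative.\<close>

lemma power_sum_part_pos:
  assumes "0 \<notin> set lam" "shape m = mset lam"
  shows "(power_sum_part lam m :: 'k::linordered_field) > 0"
  using assms
proof (induction lam arbitrary: m)
  case Nil
  then have "m = {#}" by (simp add: shape_def mset_set_empty_iff)
  then show ?case by (simp add: power_sum_part_Nil ms_one_def)
next
  case (Cons k lam)
  have "k \<in># shape m" using Cons.prems by simp
  then obtain i where i: "i \<in># m" "count m i = k" by (auto simp: shape_def)
  then have sub: "replicate_mset k i \<subseteq># m" by (auto simp: count_le_replicate_mset_subset_eq[symmetric])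
  have "i \<notin># m - replicate_mset k i" using i by (simp add: count_eq_zero_iff[symmetric])
  then have "shape (m - replicate_mset k i + replicate_mset k i) =
      add_mset k (shape (m - replicate_mset k i))"
    using Cons.prems by (intro shape_add_replicate) auto
  then have "shape (m - replicate_mset k i) = mset lam"
    using sub Cons.prems by simp
  then have "0 < (power_sum_part lam (m - replicate_mset k i) :: 'k)"
    using Cons by simp
  then have "0 < shift k (power_sum_part lam :: 'k mseries) m"
    unfolding shift_def using sub Cons.prems
    by (intro sum_pos2[of _ i]) (auto intro: power_sum_part_nonneg finite_shift_index)
  then show ?case using Cons.prems by (simp add: power_sum_part_Cons)
qed

text \<open>Each part of \<open>lam\<close> is placed on one variable. Hence at most
  \<open>length lam\<close> variables occur, and if that many occur, every part has a variable of
  its own.\<close>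

lemma power_sum_part_triangular:
  assumes "0 \<notin> set lam" "power_sum_part lam m \<noteq> (0 :: 'k::comm_ring_1)"
  shows "size (shape m) \<le> length lam \<and> (size (shape m) = length lam \<longrightarrow> shape m = mset lam)"
  using assms
proof (induction lam arbitrary: m)
  case Nil
  then show ?case by (auto simp: power_sum_part_Nil ms_one_def split: if_splits)
next
  case (Cons k lam)
  then have k: "k > 0" by auto
  then have "shift k (power_sum_part lam) m \<noteq> (0 :: 'k)" using Cons.prems by (simp add: power_sum_part_Cons)
  then obtain i where i: "replicate_mset k i \<subseteq># m" "power_sum_part lam (m - replicate_mset k i) \<noteq> (0 :: 'k)"
    unfolding shift_def by (metis (mono_tags, lifting) mem_Collect_eq sum.neutral)
  define m' where "m' = m - replicate_mset k i"
  have m: "m = m' + replicate_mset k i" using i by (simp add: m'_def)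
  have IH: "size (shape m') \<le> length lam" "size (shape m') = length lam \<Longrightarrow> shape m' = mset lam"
    using Cons i(2) by (auto simp: m'_def)
  show ?case
  proof (cases "i \<in># m'")
    case True
    then have "set_mset m = set_mset m'" using m k by auto
    then show ?thesis using IH by (simp add: size_shape)
  next
    case False
    then have "shape m = add_mset k (shape m')" unfolding m using k by (rule shape_add_replicate)
    then show ?thesis using IH by auto
  qed
qed

text \<open>With a single variable there is exactly one place for each part.\<close>

lemma power_sum_part_one_variable:
  "0 \<notin> set lam \<Longrightarrow> sum_list lam = n \<Longrightarrow> power_sum_part lam (replicate_mset n 0) = (1 :: 'k::comm_ring_1)"
proof (induction lam arbitrary: n)
  case Nil
  then show ?case by (simp add: power_sum_part_Nil ms_one_def)
next
  case (Cons k lam)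
  then have k: "k > 0" "n = k + sum_list lam" by auto
  have "replicate_mset k i \<subseteq># replicate_mset n 0 \<longleftrightarrow> i = 0" for i :: nat
    unfolding count_le_replicate_mset_subset_eq[symmetric] using k by simp
  then have "{i. replicate_mset k i \<subseteq># replicate_mset n (0 :: nat)} = {0}" by simp
  moreover have "replicate_mset n 0 - replicate_mset k 0 = replicate_mset (sum_list lam) (0 :: nat)"
    using k by (intro multiset_eqI) simp
  ultimately have "shift k (power_sum_part lam) (replicate_mset n 0) = (power_sum_part lam (replicate_mset (sum_list lam) 0) :: 'k)"
    unfolding shift_def by simp
  then show ?case using Cons k by (simp add: power_sum_part_Cons)
qed

section \<open>Newton's recursion\<close>

lemma z_part_superset:
  assumes "finite A" "set lam \<subseteq> A"
  shows "z_part lam = (\<Prod>i\<in>A. i ^ count_list lam i * fact (count_list lam i))"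
  unfolding z_part_def
  by (rule prod.mono_neutral_left) (use assms in \<open>auto simp: count_list_0_iff\<close>)

lemma z_part_remove1:
  assumes "k \<in> set lam"
  shows "z_part lam = k * count_list lam k * z_part (remove1 k lam)"
proof -
  let ?f = "\<lambda>lam i. i ^ count_list lam i * fact (count_list lam i) :: nat"
  have count: "count_list (remove1 k lam) i = count_list lam i - (if i = k then 1 else 0)" for i
    by (simp flip: count_mset)
  obtain c where c: "count_list lam k = Suc c"
    using assms by (cases "count_list lam k") (auto simp: count_list_0_iff)
  have "z_part lam = ?f lam k * (\<Prod>i\<in>set lam - {k}. ?f lam i)"
    unfolding z_part_def by (rule prod.remove) (use assms in auto)
  moreover have "z_part (remove1 k lam) = (\<Prod>i\<in>set lam. ?f (remove1 k lam) i)"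
    by (rule z_part_superset) (simp_all add: set_remove1_subset)
  moreover have "\<dots> = ?f (remove1 k lam) k * (\<Prod>i\<in>set lam - {k}. ?f (remove1 k lam) i)"
    by (rule prod.remove) (use assms in auto)
  moreover have "(\<Prod>i\<in>set lam - {k}. ?f (remove1 k lam) i) = (\<Prod>i\<in>set lam - {k}. ?f lam i)"
    by (rule prod.cong) (auto simp: count)
  ultimately show ?thesis by (simp add: count c algebra_simps)
qed

lemma z_part_pos: "0 \<notin> set lam \<Longrightarrow> z_part lam > 0"
  unfolding z_part_def by (rule prod_pos) (auto intro: gr0I)

text \<open>At \<open>b = 1 / alpha\<close> this is the inverse of the pairing of
  \<open>power_sum_part lam\<close> with itself.\<close>

definition cauchy_weight :: "'k::field_char_0 \<Rightarrow> nat list \<Rightarrow> 'k" where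
  "cauchy_weight b lam = b ^ length lam / of_nat (z_part lam)"

lemma cauchy_weight_remove1:
  assumes "k \<in> set lam" "0 \<notin> set lam"
  shows "of_nat (k * count_list lam k) * cauchy_weight b lam = b * cauchy_weight b (remove1 k lam)"
proof -
  have "k > 0" using assms by (auto intro: gr0I)
  moreover have "count_list lam k > 0" using assms by (auto simp: count_list_0_iff intro: gr0I)
  moreover have "0 \<notin> set (remove1 k lam)" using assms(2) by (auto dest: notin_set_remove1)
  then have "z_part (remove1 k lam) > 0" by (rule z_part_pos)
  moreover have "length lam = Suc (length (remove1 k lam))"
    using assms(1) length_pos_if_in_set[OF assms(1)] by (simp add: length_remove1)
  ultimately show ?thesis
    by (simp add: cauchy_weight_def z_part_remove1[OF assms(1)] field_simps)
qed

text \<open>The degree \<open>n\<close> part of the product over all variables of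
  \<open>(1 - x) ^ (- b)\<close>, expanded in power sums; at \<open>b = 1\<close> the complete
  homogeneous function.\<close>

definition complete_series :: "'k::field_char_0 \<Rightarrow> nat \<Rightarrow> 'k mseries" where
  "complete_series b n m = (\<Sum>lam\<in>partitions_of n. cauchy_weight b lam * power_sum_part lam m)"

lemma is_partition_remove1: "is_partition lam \<Longrightarrow> is_partition (remove1 k lam)"
  unfolding is_partition_def by (induction lam) (auto dest: notin_set_remove1)

text \<open>A partition of \<open>n\<close> together with one of its distinct part sizes
  \<open>k\<close> corresponds to a partition of \<open>n - k\<close>; the inverse map inserts
  \<open>k\<close> at its sorted place.\<close>

lemma sum_partitions_remove1:
  "(\<Sum>lam\<in>partitions_of n. \<Sum>k\<in>set lam. f k (remove1 k lam)) =
    (\<Sum>k=1..n. \<Sum>nu\<in>partitions_of (n - k). f k nu)"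
proof -
  let ?ins = "\<lambda>k nu. partition_of (add_mset k (mset nu))"
  have ins: "is_partition (?ins k nu)" "mset (?ins k nu) = add_mset k (mset nu)"
    if "is_partition nu" "k \<ge> 1" for k nu
  proof -
    have "0 \<notin># add_mset k (mset nu)" using that by (auto simp: is_partition_def)
    then show "is_partition (?ins k nu)" by (rule is_partition_partition_of)
  qed simp
  show ?thesis
    unfolding sum.Sigma[OF finite_partitions_of ballI[OF finite_set]]
      sum.Sigma[OF finite_atLeastAtMost ballI[OF finite_partitions_of]]
  proof (rule sum.reindex_bij_witness[where
        i = "\<lambda>(k, nu). (?ins k nu, k)" and j = "\<lambda>(lam, k). (k, remove1 k lam)"], goal_cases)
    case (1 p)
    then obtain lam k where p: "p = (lam, k)" "is_partition lam" "k \<in> set lam"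
      by (auto simp: partitions_of_def)
    then have "?ins k (remove1 k lam) = lam" by (simp add: partition_of_mset)
    then show ?case using p(1) by simp
  next
    case (2 p)
    then obtain lam k where p: "p = (lam, k)" "is_partition lam" "sum_list lam = n" "k \<in> set lam"
      by (auto simp: partitions_of_def)
    moreover have "sum_list lam = k + sum_list (remove1 k lam)"
      using p(4) by (simp add: sum_list_map_remove1[of k lam "\<lambda>x. x", simplified])
    moreover have "k > 0" using p by (cases k) (simp_all add: is_partition_def)
    ultimately show ?case by (auto simp: partitions_of_def is_partition_remove1)
  next
    case (3 p)
    then obtain k nu where p: "p = (k, nu)" "is_partition nu" "k \<ge> 1"
      by (auto simp: partitions_of_def)
    then have "remove1 k (?ins k nu) = nu"
      by (intro partition_eqI is_partition_remove1 ins) auto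
    then show ?case using p(1) by simp
  next
    case (4 p)
    then obtain k nu where p: "p = (k, nu)" "is_partition nu" "k \<ge> 1" "k \<le> n" "sum_list nu = n - k"
      by (auto simp: partitions_of_def)
    have "sum_list (?ins k nu) = n" using p ins(2)[of nu k] by (simp flip: sum_mset_sum_list)
    moreover have "k \<in> set (?ins k nu)" by (simp flip: set_mset_mset)
    ultimately show ?case using p ins(1)[of nu k] by (simp add: partitions_of_def)
  qed auto
qed

lemma shift_complete_series:
  "shift k (complete_series b n) m =
    (\<Sum>nu\<in>partitions_of n. cauchy_weight b nu * shift k (power_sum_part nu) m)"
  unfolding shift_def complete_series_def sum_distrib_left by (rule sum.swap)

text \<open>Write \<open>n\<close> as the sum of \<open>k * count_list lam k\<close> over the
  distinct parts \<open>k\<close> of \<open>lam\<close>. This factor cancels against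
  \<open>z_part lam\<close> and leaves the weight of \<open>lam\<close> with one \<open>k\<close>
  removed.\<close>

lemma complete_series_newton:
  fixes b :: "'a::field_char_0"
  shows "of_nat n * complete_series b n m = b * (\<Sum>k=1..n. shift k (complete_series b (n - k)) m)"
proof -
  have "of_nat n * complete_series b n m =
      (\<Sum>lam\<in>partitions_of n. \<Sum>k\<in>set lam.
        b * (cauchy_weight b (remove1 k lam) * shift k (power_sum_part (remove1 k lam)) m))"
    unfolding complete_series_def sum_distrib_left
  proof (rule sum.cong[OF refl])
    fix lam assume "lam \<in> partitions_of n"
    then have lam: "0 \<notin> set lam" "sum_list lam = n"
      by (auto simp: partitions_of_def is_partition_def)
    have "n = (\<Sum>k\<in>set lam. k * count_list lam k)"
      using lam(2) sum_list_map_eq_sum_count[of "\<lambda>x. x" lam] by (simp add: mult.commute)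
    then have "of_nat n * (cauchy_weight b lam * power_sum_part lam m) =
        (\<Sum>k\<in>set lam. of_nat (k * count_list lam k) * cauchy_weight b lam * power_sum_part lam m)"
      by (simp add: sum_distrib_right mult.assoc)
    also have "\<dots> = (\<Sum>k\<in>set lam.
        b * (cauchy_weight b (remove1 k lam) * shift k (power_sum_part (remove1 k lam)) m))"
    proof (rule sum.cong[OF refl])
      fix k assume "k \<in> set lam"
      then have weight: "of_nat (k * count_list lam k) * cauchy_weight b lam =
          b * cauchy_weight b (remove1 k lam)"
        and part: "(power_sum_part lam m :: 'a) = shift k (power_sum_part (remove1 k lam)) m"
        using lam(1) by (simp_all only: cauchy_weight_remove1 power_sum_part_remove1[of lam k] simp_thms)
      show "of_nat (k * count_list lam k) * cauchy_weight b lam * power_sum_part lam m =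
          b * (cauchy_weight b (remove1 k lam) * shift k (power_sum_part (remove1 k lam)) m)"
        unfolding weight part by (rule mult.assoc)
    qed
    finally show "of_nat n * (cauchy_weight b lam * power_sum_part lam m) = \<dots>" .
  qed
  also have "\<dots> = (\<Sum>k=1..n. \<Sum>nu\<in>partitions_of (n - k).
      b * (cauchy_weight b nu * shift k (power_sum_part nu) m))"
    by (rule sum_partitions_remove1)
  finally show ?thesis by (simp add: shift_complete_series sum_distrib_left)
qed

text \<open>Newton's recursion in one variable. With \<open>c = Suc d\<close> the reversed sum is a
  parallel sum with value \<open>(b + of_nat d) gchoose d\<close>, and two absorption identities
  exchange the factor \<open>b\<close> for \<open>c\<close>.\<close>

lemma sum_gchoose_newton:
  fixes b :: "'a::field_char_0"
  shows "b * (\<Sum>k=1..c. (b + of_nat (c - k) - 1) gchoose (c - k)) =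
    of_nat c * ((b + of_nat c - 1) gchoose c)"
proof (cases c)
  case (Suc d)
  have "(\<Sum>k=1..c. (b + of_nat (c - k) - 1) gchoose (c - k)) =
      (\<Sum>j\<le>d. (b - 1 + of_nat j) gchoose j)"
    by (rule sum.reindex_bij_witness[where i = "\<lambda>j. c - j" and j = "\<lambda>k. c - k"])
      (auto simp: Suc algebra_simps)
  also have "\<dots> = (b + of_nat d) gchoose d"
    by (simp add: gbinomial_parallel_sum)
  finally show ?thesis
    using gbinomial_absorb_comp[of "b + of_nat d" d] gbinomial_absorption[of d "b + of_nat d"]
    by (simp add: Suc)
qed simp

text \<open>Lowering the exponent of one variable changes only its own factor, so the one-variable
  recursion applies to each variable separately. The exponents produced in this way add up to
  \<open>size m\<close>.\<close>

lemma content_weight_newton: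
  "of_nat (size m) * content_weight b m = b * (\<Sum>k=1..size m. shift k (content_weight b) m)"
proof -
  let ?A = "set_mset m"
  let ?g = "\<lambda>j. (b + of_nat j - 1) gchoose j"
  let ?rest = "\<lambda>i. \<Prod>x\<in>?A - {i}. ?g (count m x)"
  have remove: "content_weight b (m - replicate_mset k i) = ?g (count m i - k) * ?rest i"
    if "i \<in> ?A" for i k
  proof -
    have "content_weight b (m - replicate_mset k i) = (\<Prod>x\<in>?A. ?g (count (m - replicate_mset k i) x))"
      by (rule content_weight_superset) (auto dest: in_diffD)
    also have "\<dots> = ?g (count (m - replicate_mset k i) i) *
        (\<Prod>x\<in>?A - {i}. ?g (count (m - replicate_mset k i) x))"
      by (rule prod.remove) (use that in auto)
    also have "(\<Prod>x\<in>?A - {i}. ?g (count (m - replicate_mset k i) x)) = ?rest i"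
      by (rule prod.cong) auto
    finally show ?thesis by simp
  qed
  have "(\<Sum>k=1..size m. shift k (content_weight b) m) =
      (\<Sum>k=1..size m. \<Sum>i | i \<in> ?A \<and> k \<le> count m i. ?g (count m i - k) * ?rest i)"
  proof (rule sum.cong[OF refl])
    fix k assume k: "k \<in> {1..size m}"
    have "{i. replicate_mset k i \<subseteq># m} = {i. i \<in> ?A \<and> k \<le> count m i}"
      using k by (auto simp flip: count_le_replicate_mset_subset_eq count_greater_zero_iff)
    then show "shift k (content_weight b) m = (\<Sum>i | i \<in> ?A \<and> k \<le> count m i. ?g (count m i - k) * ?rest i)"
      unfolding shift_def by (intro sum.cong) (auto simp: remove)
  qed
  also have "\<dots> = (\<Sum>i\<in>?A. \<Sum>k | k \<in> {1..size m} \<and> k \<le> count m i. ?g (count m i - k) * ?rest i)"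
    by (rule sum.swap_restrict) auto
  also have "\<dots> = (\<Sum>i\<in>?A. (\<Sum>k=1..count m i. ?g (count m i - k)) * ?rest i)"
  proof (rule sum.cong[OF refl])
    fix i
    have "count m i \<le> size m" by (rule count_le_size)
    then have "{k. k \<in> {1..size m} \<and> k \<le> count m i} = {1..count m i}" by auto
    then show "(\<Sum>k | k \<in> {1..size m} \<and> k \<le> count m i. ?g (count m i - k) * ?rest i) =
        (\<Sum>k=1..count m i. ?g (count m i - k)) * ?rest i"
      by (simp add: sum_distrib_right)
  qed
  finally have "b * (\<Sum>k=1..size m. shift k (content_weight b) m) =
      (\<Sum>i\<in>?A. (b * (\<Sum>k=1..count m i. ?g (count m i - k))) * ?rest i)"
    by (simp only: sum_distrib_left[of b _ ?A] mult.assoc)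
  also have "\<dots> = (\<Sum>i\<in>?A. of_nat (count m i) * (?g (count m i) * ?rest i))"
    by (simp only: sum_gchoose_newton mult.assoc)
  also have "\<dots> = (\<Sum>i\<in>?A. of_nat (count m i) * content_weight b m)"
  proof (rule sum.cong[OF refl])
    fix i assume "i \<in> ?A"
    then show "of_nat (count m i) * (?g (count m i) * ?rest i) = of_nat (count m i) * content_weight b m"
      unfolding content_weight_def
      using prod.remove[OF finite_set_mset, of i m "\<lambda>x. ?g (count m x)"] by simp
  qed
  also have "\<dots> = of_nat (size m) * content_weight b m"
    by (simp add: size_multiset_overloaded_eq sum_distrib_right)
  finally show ?thesis by simp
qed

text \<open>In characteristic 0 Newton's recursion determines degree \<open>n\<close> from lower
  degrees once \<open>n > 0\<close>, and both sides satisfy it. Degree 0 is checked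
  directly.\<close>

lemma complete_series_eq_content_weight:
  "complete_series b n m = (if size m = n then content_weight b m else 0)"
proof (induction n arbitrary: m rule: less_induct)
  case (less n)
  show ?case
  proof (cases "size m = n")
    case False
    then have "power_sum_part lam m = (0 :: 'a)" if "lam \<in> partitions_of n" for lam
      using that by (intro power_sum_part_eq_0) (auto simp: partitions_of_def is_partition_def)
    then show ?thesis using False by (simp add: complete_series_def)
  next
    case True
    show ?thesis
    proof (cases "n = 0")
      case True
      have "partitions_of 0 = {[]}"
      proof (intro equalityI subsetI)
        fix lam assume "lam \<in> partitions_of 0"
        then show "lam \<in> {[]}" by (cases lam) (auto simp: partitions_of_def is_partition_def)
      qed (simp add: partitions_of_def is_partition_def)
      then show ?thesis
        using True \<open>size m = n\<close>
        by (simp add: complete_series_def cauchy_weight_def z_part_def power_sum_part_Nil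
            ms_one_def content_weight_def)
    next
      case False
      have "shift k (complete_series b (n - k)) m = shift k (content_weight b) m" if "k \<in> {1..n}" for k
        unfolding shift_def
      proof (rule sum.cong[OF refl])
        fix i assume "i \<in> {i. replicate_mset k i \<subseteq># m}"
        then have "size (m - replicate_mset k i) = n - k"
          using True by (simp add: size_Diff_submset)
        then show "complete_series b (n - k) (m - replicate_mset k i) =
            content_weight b (m - replicate_mset k i)"
          using less[of "n - k" "m - replicate_mset k i"] that by simp
      qed
      then have "of_nat n * complete_series b n m = of_nat n * content_weight b m"
        unfolding complete_series_newton
        using content_weight_newton[of m b] True by simp
      then show ?thesis using True False by simp
    qed
  qed
qed

section \<open>Expansions of symmetric functions\<close>

definition homogeneous_sym :: "nat \<Rightarrow> 'k::comm_ring_1 mseries \<Rightarrow> bool" where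
  "homogeneous_sym n f \<longleftrightarrow>
     (\<forall>m. f m \<noteq> 0 \<longrightarrow> size m = n) \<and> (\<forall>\<pi> m. bij \<pi> \<longrightarrow> f (image_mset \<pi> m) = f m)"

lemma symmetric_shape_cong:
  assumes "\<And>\<pi> m. bij \<pi> \<Longrightarrow> f (image_mset \<pi> m) = f m" "shape m = shape m'"
  shows "f m = f m'"
  using assms by (metis shape_eq_imp_bij)

lemma homogeneous_sym_power_sum_part:
  "lam \<in> partitions_of n \<Longrightarrow> homogeneous_sym n (power_sum_part lam)"
  unfolding homogeneous_sym_def partitions_of_def is_partition_def
  using power_sum_part_eq_0 power_sum_part_image_mset by blast

text \<open>The index set \<open>S\<close> stays general to cover both
  \<open>partitions_of n\<close> for homogeneous series and all partitions up to a degree bound for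
  other symmetric functions.\<close>

lemma monomial_expansion:
  assumes "\<And>\<pi> m. bij \<pi> \<Longrightarrow> f (image_mset \<pi> m) = (f m :: 'k::comm_ring_1)"
    and "finite S" "S \<subseteq> Collect is_partition"
    and "\<And>m. f m \<noteq> 0 \<Longrightarrow> partition_of (shape m) \<in> S"
  shows "f m = (\<Sum>lam\<in>S. f (canonical_monomial lam) * monomial_sym lam m)"
proof -
  let ?lam = "partition_of (shape m)"
  have part: "is_partition ?lam" by (intro is_partition_partition_of zero_notin_shape)
  have eq: "monomial_sym lam m = (if lam = ?lam then 1 else (0 :: 'k))" if "lam \<in> S" for lam
  proof -
    have "is_partition lam" using that assms(3) by auto
    then have "shape m = mset lam \<longleftrightarrow> lam = ?lam"
      using partition_eqI[OF _ part, of lam] by auto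
    then show ?thesis by (simp add: monomial_sym_def shape_def)
  qed
  have "(\<Sum>lam\<in>S. f (canonical_monomial lam) * monomial_sym lam m) =
      (\<Sum>lam\<in>S. if lam = ?lam then f (canonical_monomial lam) else 0)"
    by (rule sum.cong) (simp_all add: eq)
  also have "\<dots> = (if ?lam \<in> S then f (canonical_monomial ?lam) else 0)"
    using assms(2) by (simp add: sum.delta)
  also have "f (canonical_monomial ?lam) = f m"
  proof (rule symmetric_shape_cong[OF assms(1)])
    show "shape (canonical_monomial ?lam) = shape m"
      using part by (subst shape_canonical_monomial) (auto simp: is_partition_def)
  qed
  finally show ?thesis using assms(4)[of m] by auto
qed

lemma partition_of_shape_in_partitions_of: "partition_of (shape m) \<in> partitions_of (size m)"
  by (simp add: partitions_of_def is_partition_partition_of zero_notin_shape sum_mset_shape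
      flip: sum_mset_sum_list)

lemma homogeneous_sym_monomial_expansion:
  assumes "homogeneous_sym n f"
  shows "f m = (\<Sum>lam\<in>partitions_of n. f (canonical_monomial lam) * monomial_sym lam m)"
proof (rule monomial_expansion)
  fix m assume "f m \<noteq> 0"
  then show "partition_of (shape m) \<in> partitions_of n"
    using assms partition_of_shape_in_partitions_of[of m] by (auto simp: homogeneous_sym_def)
qed (use assms in \<open>auto simp: homogeneous_sym_def, auto simp: partitions_of_def\<close>)

section \<open>Linear independence and uniqueness of coefficients\<close>

definition independent_parts :: "(nat list \<Rightarrow> 'k::comm_ring_1 mseries) \<Rightarrow> bool" where
  "independent_parts b \<longleftrightarrow>
     (\<forall>S c. finite S \<longrightarrow> S \<subseteq> Collect is_partition \<longrightarrow>
        (\<forall>m. (\<Sum>lam\<in>S. c lam * b lam m) = 0) \<longrightarrow> (\<forall>lam\<in>S. c lam = 0))"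

lemma independent_partsD:
  assumes "independent_parts b" "finite S" "S \<subseteq> Collect is_partition"
    "\<And>m. (\<Sum>lam\<in>S. c lam * b lam m) = 0" "lam \<in> S"
  shows "c lam = 0"
  using assms unfolding independent_parts_def by blast

lemma independent_monomial_sym: "independent_parts (monomial_sym :: _ \<Rightarrow> 'k::comm_ring_1 mseries)"
  unfolding independent_parts_def
proof (intro allI impI ballI)
  fix S c lam
  assume S: "finite S" "S \<subseteq> Collect is_partition"
    and zero: "\<forall>m. (\<Sum>lam\<in>S. c lam * monomial_sym lam m) = (0 :: 'k)" and lam: "lam \<in> S"
  have part: "is_partition lam" using S lam by auto
  then have shape: "shape (canonical_monomial lam) = mset lam"
    by (intro shape_canonical_monomial) (simp add: is_partition_def)
  have eq: "monomial_sym mu (canonical_monomial lam) = (if mu = lam then 1 else (0 :: 'k))" if "mu \<in> S" for mu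
  proof -
    have "is_partition mu" using that S by auto
    then have "mset lam = mset mu \<longleftrightarrow> mu = lam" using partition_eqI[OF part] by auto
    then show ?thesis using shape by (simp add: monomial_sym_def shape_def)
  qed
  have "(\<Sum>mu\<in>S. c mu * monomial_sym mu (canonical_monomial lam)) =
      (\<Sum>mu\<in>S. if mu = lam then c mu else 0)"
    by (rule sum.cong) (simp_all add: eq)
  also have "\<dots> = c lam" using S lam by (simp add: sum.delta)
  finally show "c lam = 0" using zero by simp
qed

text \<open>
  A monomial with exponents \<open>lam\<close> occurs in a power sum product \<open>mu\<close> only if \<open>mu\<close> refines
  \<open>lam\<close>; hence in a vanishing combination a partition of maximal length has coefficient zero.
\<close>

lemma independent_power_sum_part:
  "independent_parts (power_sum_part :: _ \<Rightarrow> 'k::linordered_field mseries)"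
  unfolding independent_parts_def
proof (intro allI impI ballI, rule ccontr)
  fix S c lam0
  assume S: "finite S" "S \<subseteq> Collect is_partition"
    and zero: "\<forall>m. (\<Sum>lam\<in>S. c lam * power_sum_part lam m) = (0 :: 'k)"
    and lam0: "lam0 \<in> S" "c lam0 \<noteq> 0"
  let ?T = "{lam \<in> S. c lam \<noteq> 0}"
  have "finite (length ` ?T)" "length ` ?T \<noteq> {}" using S lam0 by auto
  then obtain lam where lam: "lam \<in> ?T" "length lam = Max (length ` ?T)"
    using Max_in by (metis (no_types, lifting) imageE)
  have max: "length mu \<le> length lam" if "mu \<in> ?T" for mu
    unfolding lam(2) using \<open>finite (length ` ?T)\<close> that by (intro Max_ge) auto
  have part: "is_partition lam" using S lam by auto
  then have pos: "0 \<notin> set lam" by (simp add: is_partition_def)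
  define m where "m = canonical_monomial lam"
  have shape: "shape m = mset lam" unfolding m_def using pos by (rule shape_canonical_monomial)
  have "c mu * power_sum_part mu m = 0" if mu: "mu \<in> S - {lam}" for mu
  proof (rule ccontr)
    assume "c mu * power_sum_part mu m \<noteq> 0"
    then have nz: "mu \<in> ?T" "power_sum_part mu m \<noteq> (0 :: 'k)" using mu by auto
    have mu_part: "is_partition mu" using mu S by auto
    then have "0 \<notin> set mu" by (simp add: is_partition_def)
    from power_sum_part_triangular[OF this nz(2)] max[OF nz(1)]
    have "mset lam = mset mu" unfolding shape by simp
    then have "lam = mu" by (rule partition_eqI[OF part mu_part])
    then show False using mu by simp
  qed
  then have "(\<Sum>mu\<in>S - {lam}. c mu * power_sum_part mu m) = 0"
    by (intro sum.neutral ballI)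
  then have "(\<Sum>mu\<in>S. c mu * power_sum_part mu m) = c lam * power_sum_part lam m"
    using sum.remove[OF S(1), of lam "\<lambda>mu. c mu * power_sum_part mu m"] lam(1) by simp
  moreover have "power_sum_part lam m > (0 :: 'k)" using pos shape by (rule power_sum_part_pos)
  ultimately show False using zero lam(1) by auto
qed

text \<open>Two expansions differ by a vanishing combination over the union of their supports.
  Independence thus makes the description in \<open>part_coeff\<close> definite.\<close>

lemma part_coeff_eqI:
  assumes "independent_parts b" "part_expansion b f c"
  shows "part_coeff b f = c"
  unfolding part_coeff_def
proof (rule the_equality[where P = "part_expansion b f", OF assms(2)])
  fix d assume d: "part_expansion b f d"
  let ?S = "{lam. c lam \<noteq> 0} \<union> {lam. d lam \<noteq> 0}"
  have fin: "finite ?S" and part: "?S \<subseteq> Collect is_partition"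
    using d assms(2) by (auto simp: part_expansion_def)
  have f: "f m = (\<Sum>lam\<in>?S. e lam * b lam m)"
    if "part_expansion b f e" "{lam. e lam \<noteq> 0} \<subseteq> ?S" for e m
  proof -
    have "f m = (\<Sum>lam | e lam \<noteq> 0. e lam * b lam m)"
      using that(1) by (auto simp: part_expansion_def)
    also have "\<dots> = (\<Sum>lam\<in>?S. e lam * b lam m)"
      by (rule sum.mono_neutral_left) (use fin that(2) in auto)
    finally show ?thesis .
  qed
  have "(\<Sum>lam\<in>?S. (d lam - c lam) * b lam m) = 0" for m
    using f[OF d, of m] f[OF assms(2), of m] by (simp add: left_diff_distrib sum_subtractf)
  then have "d lam - c lam = 0" if "lam \<in> ?S" for lam
    using independent_partsD[OF assms(1) fin part, of "\<lambda>lam. d lam - c lam"] that by blast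
  then show "d = c" by (auto simp: fun_eq_iff) (metis (mono_tags) right_minus_eq)+
qed

lemma part_expansionI:
  assumes "finite S" "S \<subseteq> Collect is_partition" "\<And>lam. lam \<notin> S \<Longrightarrow> c lam = 0"
    "\<And>m. f m = (\<Sum>lam\<in>S. c lam * b lam m)"
  shows "part_expansion b f c"
  unfolding part_expansion_def
proof (intro conjI allI impI ext)
  have sub: "{lam. c lam \<noteq> 0} \<subseteq> S" using assms(3) by auto
  then show "finite {lam. c lam \<noteq> 0}" using assms(1) by (rule finite_subset)
  show "is_partition lam" if "c lam \<noteq> 0" for lam using that sub assms(2) by auto
  show "f m = (\<Sum>lam | c lam \<noteq> 0. c lam * b lam m)" for m
    unfolding assms(4) by (rule sum.mono_neutral_right) (use sub assms(1) in auto)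
qed

lemma part_coeff_monomial_sym:
  assumes "symmetric_function f" "is_partition lam"
  shows "part_coeff monomial_sym f lam = f (canonical_monomial lam)"
proof -
  obtain d where d: "\<And>m. size m > d \<Longrightarrow> f m = 0"
    using assms(1) by (auto simp: symmetric_function_def)
  have sym: "f (image_mset \<pi> m) = f m" if "bij \<pi>" for \<pi> m
    using assms(1) that by (auto simp: symmetric_function_def)
  \<comment> \<open>\<open>lam\<close> is added so that its coefficient is covered even when its
    size exceeds the degree bound \<open>d\<close>.\<close>
  let ?S = "insert lam {lam. is_partition lam \<and> sum_list lam \<le> d}"
  have fin: "finite ?S" using finite_partitions_le by simp
  have part: "?S \<subseteq> Collect is_partition" using assms(2) by auto
  have "part_expansion monomial_sym f (\<lambda>lam. if lam \<in> ?S then f (canonical_monomial lam) else 0)"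
  proof (rule part_expansionI[OF fin part])
    fix m
    have "partition_of (shape m) \<in> ?S" if "f m \<noteq> 0" for m
      using that d[of m] partition_of_shape_in_partitions_of[of m]
      by (auto simp: partitions_of_def not_less[symmetric])
    then have "f m = (\<Sum>lam\<in>?S. f (canonical_monomial lam) * monomial_sym lam m)"
      by (intro monomial_expansion sym fin part)
    also have "\<dots> = (\<Sum>lam\<in>?S. (if lam \<in> ?S then f (canonical_monomial lam) else 0) * monomial_sym lam m)"
      by (rule sum.cong) simp_all
    finally show "f m = \<dots>" .
  qed auto
  from part_coeff_eqI[OF independent_monomial_sym this] show ?thesis by simp
qed

text \<open>A dimension count: if \<open>f\<close> were outside the span of the \<open>p i\<close>,
  then \<open>f\<close> and the \<open>p i\<close> would be more than \<open>card I\<close>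
  independent vectors in the span of at most \<open>card I\<close> vectors.\<close>

lemma independent_family_spans:
  fixes b p :: "'i \<Rightarrow> 'x \<Rightarrow> 'k::field"
  assumes "finite I"
    and p: "\<And>i. i \<in> I \<Longrightarrow> \<exists>c. \<forall>x. p i x = (\<Sum>j\<in>I. c j * b j x)"
    and indep: "\<And>c. (\<And>x. (\<Sum>i\<in>I. c i * p i x) = 0) \<Longrightarrow> \<forall>i\<in>I. c i = 0"
    and f: "\<exists>c. \<forall>x. f x = (\<Sum>j\<in>I. c j * b j x)"
  shows "\<exists>c. \<forall>x. f x = (\<Sum>i\<in>I. c i * p i x)"
proof -
  interpret vector_space "\<lambda>(c::'k) (f::'x \<Rightarrow> 'k) x. c * f x"
    by unfold_locales (auto simp: fun_eq_iff algebra_simps)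
  have sum_fun: "(\<Sum>i\<in>A. g i) x = (\<Sum>i\<in>A. g i x)" for A :: "'y set" and g :: "'y \<Rightarrow> 'x \<Rightarrow> 'k" and x
    by (induction A rule: infinite_finite_induct) auto
  have in_span: "g \<in> span (b ` I)" if expansion: "\<exists>c. \<forall>x. g x = (\<Sum>j\<in>I. c j * b j x)" for g
  proof -
    obtain c where "\<forall>x. g x = (\<Sum>j\<in>I. c j * b j x)" using expansion by blast
    then have "g = (\<Sum>j\<in>I. (\<lambda>x. c j * b j x))" by (simp add: fun_eq_iff sum_fun)
    also have "\<dots> \<in> span (b ` I)"
      by (intro span_sum span_scale span_base) auto
    finally show ?thesis .
  qed
  have inj: "inj_on p I"
  proof (rule inj_onI, rule ccontr)
    fix i j assume ij: "i \<in> I" "j \<in> I" "p i = p j" "i \<noteq> j"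
    let ?c = "\<lambda>k. if k = i then 1 else if k = j then -1 else (0 :: 'k)"
    have "(\<Sum>k\<in>I. ?c k * p k x) = 0" for x
    proof -
      have "(\<Sum>k\<in>I. ?c k * p k x) = (\<Sum>k\<in>I. (if k = i then p i x else 0) - (if k = j then p j x else 0))"
        by (rule sum.cong) (use ij in auto)
      also have "\<dots> = 0" using ij assms(1) by (simp add: sum_subtractf)
      finally show ?thesis .
    qed
    then have "?c i = 0" using indep[of ?c] ij by blast
    then show False by simp
  qed
  have "independent (p ` I)"
    unfolding independent_explicit_finite_subsets
  proof (intro allI impI ballI)
    fix S u v
    assume S: "S \<subseteq> p ` I" "finite S" and zero: "(\<Sum>v\<in>S. (\<lambda>x. u v * v x)) = 0" and v: "v \<in> S"
    obtain i where i: "i \<in> I" "v = p i" using v S by auto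
    let ?c = "\<lambda>i. if p i \<in> S then u (p i) else 0"
    have "(\<Sum>i\<in>I. ?c i * p i x) = 0" for x
    proof -
      have "(\<Sum>i\<in>I. ?c i * p i x) = (\<Sum>v\<in>p ` I. (if v \<in> S then u v else 0) * v x)"
        by (simp add: sum.reindex[OF inj])
      also have "\<dots> = (\<Sum>v\<in>S. u v * v x)"
        by (rule sum.mono_neutral_cong_right) (use S assms(1) in auto)
      also have "\<dots> = 0" using fun_cong[OF zero, of x] by (simp add: sum_fun)
      finally show ?thesis .
    qed
    then have "?c i = 0" using indep[of ?c] i by blast
    then show "u v = 0" using i v by simp
  qed
  have "f \<in> span (p ` I)"
  proof (rule ccontr)
    assume notin: "f \<notin> span (p ` I)"
    then have "independent (insert f (p ` I))"
      using \<open>independent (p ` I)\<close> by (simp add: independent_insert)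
    moreover have "insert f (p ` I) \<subseteq> span (b ` I)" using in_span f p by auto
    ultimately have "card (insert f (p ` I)) \<le> card (b ` I)"
      using independent_span_bound[of "b ` I"] assms(1) by blast
    moreover have "f \<notin> p ` I" using notin span_base by blast
    ultimately have "Suc (card I) \<le> card (b ` I)" using assms(1) by (simp add: card_image[OF inj])
    then show False using card_image_le[OF assms(1), of b] by simp
  qed
  then obtain u where "f = (\<Sum>v\<in>p ` I. (\<lambda>x. u v * v x))"
    using span_finite[of "p ` I"] assms(1) by auto
  then have "f x = (\<Sum>i\<in>I. u (p i) * p i x)" for x
    by (simp add: sum_fun sum.reindex[OF inj])
  then show ?thesis by (intro exI[of _ "\<lambda>i. u (p i)"]) simp
qed

lemma homogeneous_sym_spanned:
  fixes p :: "nat list \<Rightarrow> 'k::field mseries"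
  assumes "\<And>lam. lam \<in> partitions_of n \<Longrightarrow> homogeneous_sym n (p lam)"
    and "\<And>c. (\<And>m. (\<Sum>lam\<in>partitions_of n. c lam * p lam m) = 0) \<Longrightarrow> \<forall>lam\<in>partitions_of n. c lam = 0"
    and "homogeneous_sym n f"
  shows "\<exists>c. \<forall>m. f m = (\<Sum>lam\<in>partitions_of n. c lam * p lam m)"
proof (rule independent_family_spans[OF finite_partitions_of])
  have expansion: "\<exists>c. \<forall>m. g m = (\<Sum>lam\<in>partitions_of n. c lam * monomial_sym lam m)"
    if "homogeneous_sym n g" for g :: "'k mseries"
    by (intro exI[of _ "\<lambda>lam. g (canonical_monomial lam)"] allI
        homogeneous_sym_monomial_expansion[OF that])
  show "\<exists>c. \<forall>m. p lam m = (\<Sum>mu\<in>partitions_of n. c mu * monomial_sym mu m)"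
    if "lam \<in> partitions_of n" for lam
    using expansion[OF assms(1)[OF that]] .
  show "\<exists>c. \<forall>m. f m = (\<Sum>mu\<in>partitions_of n. c mu * monomial_sym mu m)"
    by (rule expansion[OF assms(3)])
qed (rule assms(2))

section \<open>The Jack inner product\<close>

lemma part_coeff_power_sum_eqI:
  fixes f :: "'k::linordered_field mseries"
  assumes "\<And>m. f m = (\<Sum>lam\<in>partitions_of n. c lam * power_sum_part lam m)" "lam \<in> partitions_of n"
  shows "part_coeff power_sum_part f lam = c lam"
proof -
  let ?c = "\<lambda>lam. if lam \<in> partitions_of n then c lam else 0"
  have "f m = (\<Sum>lam\<in>partitions_of n. ?c lam * power_sum_part lam m)" for m
    unfolding assms(1) by (rule sum.cong) auto
  then have "part_expansion power_sum_part f ?c"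
    by (intro part_expansionI[OF finite_partitions_of[of n]]) (auto simp: partitions_of_def)
  from part_coeff_eqI[OF independent_power_sum_part this] show ?thesis using assms(2) by simp
qed

lemma homogeneous_sym_power_sum_expansion:
  fixes f :: "'k::linordered_field mseries"
  assumes "homogeneous_sym n f"
  shows "part_coeff power_sum_part f lam \<noteq> 0 \<Longrightarrow> lam \<in> partitions_of n"
    and "f m = (\<Sum>lam\<in>partitions_of n. part_coeff power_sum_part f lam * power_sum_part lam m)"
proof -
  have sub: "partitions_of n \<subseteq> Collect is_partition" by (auto simp: partitions_of_def)
  have "\<exists>c. \<forall>m. f m = (\<Sum>lam\<in>partitions_of n. c lam * power_sum_part lam m)"
    using independent_partsD[OF independent_power_sum_part finite_partitions_of sub]
    by (intro homogeneous_sym_spanned[OF homogeneous_sym_power_sum_part _ assms] ballI) auto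
  then obtain c where c: "\<And>m. f m = (\<Sum>lam\<in>partitions_of n. c lam * power_sum_part lam m)"
    by blast
  let ?c = "\<lambda>lam. if lam \<in> partitions_of n then c lam else 0"
  have "f m = (\<Sum>lam\<in>partitions_of n. ?c lam * power_sum_part lam m)" for m
    unfolding c by (rule sum.cong) auto
  moreover from this have "part_expansion power_sum_part f ?c"
    by (intro part_expansionI[OF finite_partitions_of[of n] sub]) auto
  then have "part_coeff power_sum_part f = ?c"
    by (rule part_coeff_eqI[OF independent_power_sum_part])
  ultimately show "part_coeff power_sum_part f lam \<noteq> 0 \<Longrightarrow> lam \<in> partitions_of n"
    and "f m = (\<Sum>lam\<in>partitions_of n. part_coeff power_sum_part f lam * power_sum_part lam m)"
    by (auto split: if_splits)
qed

lemma jack_inner_eq: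
  assumes "homogeneous_sym n f" "homogeneous_sym n g"
  shows "jack_inner f g = (\<Sum>lam\<in>partitions_of n.
    part_coeff power_sum_part f lam * part_coeff power_sum_part g lam *
    (of_nat (z_part lam) * alpha ^ length lam))"
proof -
  let ?c = "part_coeff power_sum_part f" and ?d = "part_coeff power_sum_part g"
  let ?P = "partitions_of n"
  have sub: "{lam. ?c lam \<noteq> 0} \<subseteq> ?P" "{lam. ?d lam \<noteq> 0} \<subseteq> ?P"
    using homogeneous_sym_power_sum_expansion(1) assms by blast+
  have fin: "finite {nu. ?d nu \<noteq> 0}" using sub(2) by (rule finite_subset) simp
  have "jack_inner f g = (\<Sum>lam | ?c lam \<noteq> 0. \<Sum>nu | ?d nu \<noteq> 0. ?c lam * ?d nu * power_sum_pairing lam nu)"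
    by (simp add: jack_inner_def Let_def)
  also have "\<dots> = (\<Sum>lam | ?c lam \<noteq> 0. ?c lam * ?d lam * (of_nat (z_part lam) * alpha ^ length lam))"
  proof (rule sum.cong[OF refl])
    fix lam
    have "(\<Sum>nu | ?d nu \<noteq> 0. ?c lam * ?d nu * power_sum_pairing lam nu) =
        (\<Sum>nu | ?d nu \<noteq> 0. if nu = lam then ?c lam * ?d lam * (of_nat (z_part lam) * alpha ^ length lam) else 0)"
      by (rule sum.cong) (auto simp: power_sum_pairing_def)
    also have "\<dots> = ?c lam * ?d lam * (of_nat (z_part lam) * alpha ^ length lam)"
      using fin by (simp add: sum.delta)
    finally show "(\<Sum>nu | ?d nu \<noteq> 0. ?c lam * ?d nu * power_sum_pairing lam nu) = \<dots>" .
  qed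
  also have "\<dots> = (\<Sum>lam\<in>?P. ?c lam * ?d lam * (of_nat (z_part lam) * alpha ^ length lam))"
    by (rule sum.mono_neutral_left) (use sub in auto)
  finally show ?thesis .
qed

text \<open>
  Polynomials over an ordered field are ordered by the sign of the leading coefficient, which
  makes the indeterminate a positive element of an ordered field.
\<close>

lemma alpha_pos: "alpha > 0"
proof -
  have "(0 :: rat poly) < [:0, 1:]" by (simp add: less_poly_def pos_poly_pCons)
  then show ?thesis by (simp add: alpha_def to_fract_def zero_less_Fract_iff)
qed

text \<open>In power sum coordinates the pairing of \<open>f\<close> with itself is a sum of squares
  with weights that are positive because \<open>alpha > 0\<close>; one of the squares is
  nonzero.\<close>

lemma jack_inner_self_pos:
  assumes "homogeneous_sym n f" "f m \<noteq> 0"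
  shows "jack_inner f f > 0"
proof -
  let ?c = "part_coeff power_sum_part f"
  have weight: "of_nat (z_part lam) * alpha ^ length lam > 0" if "lam \<in> partitions_of n" for lam
    using that alpha_pos z_part_pos[of lam]
    by (simp add: partitions_of_def is_partition_def)
  have "\<exists>lam\<in>partitions_of n. ?c lam \<noteq> 0"
    using assms homogeneous_sym_power_sum_expansion(2)[OF assms(1), of m]
    by (metis (no_types, lifting) mult_zero_left sum.neutral)
  then obtain lam where lam: "lam \<in> partitions_of n" "?c lam \<noteq> 0" by blast
  show ?thesis
    unfolding jack_inner_eq[OF assms(1,1)]
  proof (rule sum_pos2[OF finite_partitions_of lam(1)])
    have "?c lam * ?c lam > 0" using lam(2) by (auto simp: zero_less_mult_iff linorder_neq_iff)
    then show "?c lam * ?c lam * (of_nat (z_part lam) * alpha ^ length lam) > 0"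
      using weight[OF lam(1)] by (rule mult_pos_pos)
    show "?c nu * ?c nu * (of_nat (z_part nu) * alpha ^ length nu) \<ge> 0" if "nu \<in> partitions_of n" for nu
      using weight[OF that] by (intro mult_nonneg_nonneg zero_le_square less_imp_le)
  qed
qed

text \<open>Since \<open>part_coeff\<close> is a description, linearity rests on uniqueness: the
  combined coefficients give a power sum expansion of \<open>f\<close>, hence they are its
  coefficients.\<close>

lemma jack_inner_sum_left:
  assumes "\<And>i. i \<in> I \<Longrightarrow> homogeneous_sym n (p i)" "homogeneous_sym n f" "homogeneous_sym n g"
    and "\<And>m. f m = (\<Sum>i\<in>I. c i * p i m)"
  shows "jack_inner f g = (\<Sum>i\<in>I. c i * jack_inner (p i) g)"
proof -
  let ?pc = "part_coeff power_sum_part"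
  have "f m = (\<Sum>lam\<in>partitions_of n. (\<Sum>i\<in>I. c i * ?pc (p i) lam) * power_sum_part lam m)" for m
  proof -
    have "f m = (\<Sum>i\<in>I. c i * (\<Sum>lam\<in>partitions_of n. ?pc (p i) lam * power_sum_part lam m))"
      unfolding assms(4)
      using homogeneous_sym_power_sum_expansion(2)[OF assms(1)] by (intro sum.cong) auto
    also have "\<dots> = (\<Sum>i\<in>I. \<Sum>lam\<in>partitions_of n. c i * ?pc (p i) lam * power_sum_part lam m)"
      by (simp add: sum_distrib_left mult.assoc)
    also have "\<dots> = (\<Sum>lam\<in>partitions_of n. \<Sum>i\<in>I. c i * ?pc (p i) lam * power_sum_part lam m)"
      by (rule sum.swap)
    finally show ?thesis by (simp add: sum_distrib_right)
  qed
  then have coeff: "?pc f lam = (\<Sum>i\<in>I. c i * ?pc (p i) lam)" if "lam \<in> partitions_of n" for lam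
    using that by (rule part_coeff_power_sum_eqI)
  let ?w = "\<lambda>lam. of_nat (z_part lam) * alpha ^ length lam"
  have "jack_inner f g =
      (\<Sum>lam\<in>partitions_of n. \<Sum>i\<in>I. c i * (?pc (p i) lam * ?pc g lam * ?w lam))"
    unfolding jack_inner_eq[OF assms(2,3)]
    by (rule sum.cong) (simp_all add: coeff sum_distrib_right mult.assoc)
  also have "\<dots> = (\<Sum>i\<in>I. \<Sum>lam\<in>partitions_of n. c i * (?pc (p i) lam * ?pc g lam * ?w lam))"
    by (rule sum.swap)
  also have "\<dots> = (\<Sum>i\<in>I. c i * jack_inner (p i) g)"
    by (rule sum.cong) (simp_all add: jack_inner_eq[OF assms(1,3)] sum_distrib_left)
  finally show ?thesis .
qed

lemma homogeneous_sym_complete_series: "homogeneous_sym n (complete_series b n)"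
proof -
  have "complete_series b n (image_mset \<pi> m) = complete_series b n m" if "bij \<pi>" for \<pi> m
    unfolding complete_series_def
    using power_sum_part_image_mset[OF that]
    by (intro sum.cong) (auto simp: partitions_of_def is_partition_def)
  then show ?thesis by (auto simp: homogeneous_sym_def complete_series_eq_content_weight)
qed

text \<open>
  The pairing with this series sends every power sum product of degree \<open>n\<close> to 1, as does
  the extraction of the coefficient of a pure \<open>n\<close>-th power.
\<close>

lemma jack_inner_complete_series:
  assumes "homogeneous_sym n f"
  shows "jack_inner (complete_series (1 / alpha) n) f = f (replicate_mset n 0)"
proof -
  let ?pc = "part_coeff power_sum_part"
  have coeff: "?pc (complete_series (1 / alpha) n) lam = cauchy_weight (1 / alpha) lam"
    if "lam \<in> partitions_of n" for lam
    using complete_series_def that by (rule part_coeff_power_sum_eqI)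
  have one: "cauchy_weight (1 / alpha) lam * x * (of_nat (z_part lam) * alpha ^ length lam) = x"
    if "lam \<in> partitions_of n" for lam x
  proof -
    have "z_part lam > 0" using that by (intro z_part_pos) (simp add: partitions_of_def is_partition_def)
    then show ?thesis using alpha_pos by (simp add: cauchy_weight_def power_one_over field_simps)
  qed
  have "jack_inner (complete_series (1 / alpha) n) f = (\<Sum>lam\<in>partitions_of n. ?pc f lam)"
    unfolding jack_inner_eq[OF homogeneous_sym_complete_series assms]
    by (rule sum.cong) (simp_all only: coeff one)
  also have "\<dots> = (\<Sum>lam\<in>partitions_of n. ?pc f lam * power_sum_part lam (replicate_mset n 0))"
    by (rule sum.cong) (simp_all add: partitions_of_def is_partition_def power_sum_part_one_variable)
  also have "\<dots> = f (replicate_mset n 0)"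
    using homogeneous_sym_power_sum_expansion(2)[OF assms] by simp
  finally show ?thesis .
qed

section \<open>The Jack function of a one-row partition\<close>

definition eval_ratpoly :: "rat poly \<Rightarrow> 'k::field_char_0 \<Rightarrow> 'k" where
  "eval_ratpoly p t = poly (map_poly of_rat p) t"

lemma eval_ratpoly_0 [simp]: "eval_ratpoly 0 t = 0"
  by (simp add: eval_ratpoly_def)

lemma eval_ratpoly_pCons [simp]: "eval_ratpoly (pCons a p) t = of_rat a + t * eval_ratpoly p t"
  by (simp add: eval_ratpoly_def map_poly_pCons)

lemma eval_ratpoly_add: "eval_ratpoly (p + q) t = eval_ratpoly p t + eval_ratpoly q t"
  by (induction p q rule: poly_induct2) (simp_all add: of_rat_add algebra_simps)

lemma eval_ratpoly_smult: "eval_ratpoly (smult c p) t = of_rat c * eval_ratpoly p t"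
  by (induction p) (simp_all add: of_rat_mult algebra_simps)

lemma eval_ratpoly_mult: "eval_ratpoly (p * q) t = eval_ratpoly p t * eval_ratpoly q t"
  by (induction p) (simp_all add: eval_ratpoly_add eval_ratpoly_smult algebra_simps)

lemma eval_ratpoly_prod: "eval_ratpoly (\<Prod>x\<in>A. f x) t = (\<Prod>x\<in>A. eval_ratpoly (f x) t)"
  by (induction A rule: infinite_finite_induct) (simp_all add: eval_ratpoly_mult one_pCons)

lemma of_rat_fact: "of_rat (fact c) = fact c"
  by (metis of_nat_fact of_rat_of_nat_eq)

lemma to_fract_const: "to_fract [:a:] = (of_rat a :: ratfun)"
proof -
  obtain k l where a: "a = Rat.Fract k l" "l > 0" by (cases a) auto
  have of_int: "to_fract [:of_int i:] = (of_int i :: ratfun)" for i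
  proof -
    have "to_fract (of_nat j :: rat poly) = of_nat j" for j by (induction j) simp_all
    then have "to_fract (of_int i :: rat poly) = of_int i" by (cases i rule: int_diff_cases) simp
    then show ?thesis by (simp add: of_int_poly)
  qed
  have "to_fract [:a:] * to_fract [:of_int l:] = to_fract [:of_int k:]"
    using a by (simp add: Fract_of_int_quotient flip: to_fract_mult)
  then have "to_fract [:a:] = of_int k / of_int l"
    using a(2) by (simp add: of_int field_simps)
  then show ?thesis using a by (simp add: of_rat_rat)
qed

lemma to_fract_eq_eval_ratpoly: "to_fract p = eval_ratpoly p alpha"
proof (induction p)
  case (pCons a p)
  have "pCons a p = [:a:] + [:0, 1:] * p" by simp
  then have "to_fract (pCons a p) = to_fract [:a:] + alpha * to_fract p"
    by (simp only: to_fract_add to_fract_mult alpha_def)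
  then show ?case using pCons by (simp add: to_fract_const)
qed simp

text \<open>A polynomial in \<open>alpha\<close> has reduced denominator 1, so substitution is plain
  evaluation. The coefficients in question are polynomials, and no other fraction has to be
  reduced.\<close>

lemma subst_alpha_eval_ratpoly: "subst_alpha t (eval_ratpoly p alpha) = eval_ratpoly p t"
  by (simp flip: to_fract_eq_eval_ratpoly)
    (simp add: subst_alpha_def eval_ratpoly_def one_pCons map_poly_pCons)

text \<open>The product of \<open>1 + j * t\<close> over \<open>j < c\<close>, divided by
  \<open>fact c\<close>: the binomial \<open>(1 / t + of_nat c - 1) gchoose c\<close> cleared of
  powers of \<open>t\<close> in the denominator.\<close>

definition rising_poly :: "nat \<Rightarrow> rat poly" where
  "rising_poly c = smult (inverse (fact c)) (\<Prod>i=0..<c. [:1, of_nat (c - 1 - i):])"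

lemma eval_rising_poly:
  fixes t :: "'k::field_char_0"
  assumes "t \<noteq> 0"
  shows "eval_ratpoly (rising_poly c) t = t ^ c * ((1 / t + of_nat c - 1) gchoose c)"
proof -
  have "eval_ratpoly (rising_poly c) t = inverse (fact c) * (\<Prod>i=0..<c. 1 + t * of_nat (c - 1 - i))"
    by (simp add: rising_poly_def eval_ratpoly_smult eval_ratpoly_prod of_rat_inverse of_rat_fact
        of_rat_diff of_rat_add)
  also have "(\<Prod>i=0..<c. 1 + t * of_nat (c - 1 - i)) =
      (\<Prod>i=0..<c. t * (1 / t + of_nat c - 1 - of_nat i))"
    by (rule prod.cong) (use assms in \<open>auto simp: of_nat_diff field_simps\<close>)
  also have "\<dots> = t ^ c * (\<Prod>i=0..<c. 1 / t + of_nat c - 1 - of_nat i)"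
    by (simp add: prod.distrib)
  finally show ?thesis by (simp add: gbinomial_prod_rev field_simps)
qed

lemma eval_prod_rising_poly:
  fixes t :: "'k::field_char_0"
  assumes "t \<noteq> 0"
  shows "eval_ratpoly (\<Prod>x\<in>set_mset m. rising_poly (count m x)) t =
    t ^ size m * content_weight (1 / t) m"
  by (simp add: eval_ratpoly_prod eval_rising_poly[OF assms] content_weight_def prod.distrib
      size_multiset_overloaded_eq power_sum)

lemma content_weight_squarefree:
  assumes "shape m = mset (replicate n 1)"
  shows "content_weight b m = b ^ n"
proof -
  have "count m x = 1" if "x \<in># m" for x
  proof -
    have "count m x \<in># shape m" using that by (simp add: shape_def)
    then show ?thesis using assms by (simp split: if_splits)
  qed
  moreover have "card (set_mset m) = n" using assms by (simp flip: size_shape)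
  ultimately show ?thesis by (simp add: content_weight_def)
qed

text \<open>The dominance condition at \<open>k = 1\<close> forces the first part of
  \<open>mu\<close> to be at least \<open>n\<close>, which leaves nothing for further parts.\<close>

lemma dominance_le_one_row:
  assumes "is_partition mu" "dominance_le [n] mu" "n \<ge> 1"
  shows "mu = [n]"
proof -
  have sum: "sum_list mu = n" and le: "n \<le> sum_list (take 1 mu)"
    using assms(2) by (auto simp: dominance_le_def dest: spec[of _ 1])
  then obtain a as where mu: "mu = a # as" using assms(3) by (cases mu) auto
  then have "sum_list as = 0" using sum le by (simp del: sum_list_eq_0_iff)
  moreover have "0 \<notin> set as" using assms(1) mu by (simp add: is_partition_def)
  ultimately have "as = []" by (cases as) auto
  then show ?thesis using mu sum by simp
qed

section \<open>The Jack functions as an orthogonal basis\<close>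

context
  fixes J :: "nat list \<Rightarrow> ratfun mseries"
  assumes J: "integral_jack_family J"
begin

lemma jack_monomial_coeff:
  "is_partition mu \<Longrightarrow> is_partition lam \<Longrightarrow>
    part_coeff monomial_sym (J mu) lam = J mu (canonical_monomial lam)"
  using J by (intro part_coeff_monomial_sym) (simp_all add: integral_jack_family_def)

lemma jack_nonzero_imp_dominance_le:
  assumes mu: "is_partition mu" and "J mu m \<noteq> 0"
  shows "dominance_le (partition_of (shape m)) mu"
proof -
  let ?lam = "partition_of (shape m)"
  have lam: "is_partition ?lam" by (intro is_partition_partition_of zero_notin_shape)
  have "J mu (canonical_monomial ?lam) = J mu m"
  proof (rule symmetric_shape_cong)
    show "J mu (image_mset \<pi> m) = J mu m" if "bij \<pi>" for \<pi> m
      using J mu that by (simp add: integral_jack_family_def symmetric_function_def)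
    show "shape (canonical_monomial ?lam) = shape m"
      using lam by (subst shape_canonical_monomial) (auto simp: is_partition_def)
  qed
  then have "part_coeff monomial_sym (J mu) ?lam \<noteq> 0"
    using assms(2) jack_monomial_coeff[OF mu lam] by simp
  then show ?thesis using J mu lam by (simp add: integral_jack_family_def)
qed

text \<open>Homogeneity is not among the axioms of the family; it follows from triangularity because
  dominance compares only partitions of the same number.\<close>

lemma homogeneous_sym_jack:
  assumes "mu \<in> partitions_of n"
  shows "homogeneous_sym n (J mu)"
  unfolding homogeneous_sym_def
proof (intro conjI allI impI)
  have mu: "is_partition mu" "sum_list mu = n" using assms by (auto simp: partitions_of_def)
  show "J mu (image_mset \<pi> m) = J mu m" if "bij \<pi>" for \<pi> m
    using J mu(1) that by (simp add: integral_jack_family_def symmetric_function_def)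
  show "size m = n" if "J mu m \<noteq> 0" for m
    using jack_nonzero_imp_dominance_le[OF mu(1) that] partition_of_shape_in_partitions_of[of m] mu(2)
    by (simp add: dominance_le_def partitions_of_def)
qed

lemma jack_squarefree_coeff:
  assumes "mu \<in> partitions_of n"
  shows "J mu (canonical_monomial (replicate n 1)) = fact n"
proof -
  have "is_partition (replicate n 1)" by (simp add: is_partition_def sorted_wrt_iff_nth_less)
  moreover have mu: "is_partition mu" "sum_list mu = n" using assms by (auto simp: partitions_of_def)
  ultimately have "J mu (canonical_monomial (replicate n 1)) =
      part_coeff monomial_sym (J mu) (replicate (sum_list mu) 1)"
    using jack_monomial_coeff by simp
  moreover have "part_coeff monomial_sym (J mu) (replicate (sum_list mu) 1) = fact (sum_list mu)"
    using J mu(1) unfolding integral_jack_family_def by blast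
  ultimately show ?thesis using mu(2) by simp
qed

text \<open>The normalization gives \<open>J mu\<close> a nonzero coefficient, so its pairing with
  itself is positive; orthogonality covers the other pairs.\<close>

lemma jack_inner_jack:
  assumes "mu \<in> partitions_of n" "nu \<in> partitions_of n"
  shows "jack_inner (J mu) (J nu) = 0 \<longleftrightarrow> mu \<noteq> nu"
proof -
  have "jack_inner (J mu) (J mu) > 0"
    using jack_inner_self_pos[OF homogeneous_sym_jack] jack_squarefree_coeff assms(1)
    by (metis fact_nonzero)
  moreover have "jack_inner (J mu) (J nu) = 0" if "mu \<noteq> nu"
    using that J assms by (simp add: integral_jack_family_def partitions_of_def)
  ultimately show ?thesis by auto
qed

lemma jack_inner_jack_combination:
  assumes "\<And>m. f m = (\<Sum>mu\<in>partitions_of n. c mu * J mu m)" "homogeneous_sym n f"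
    and nu: "nu \<in> partitions_of n"
  shows "jack_inner f (J nu) = c nu * jack_inner (J nu) (J nu)"
proof -
  have "jack_inner f (J nu) = (\<Sum>mu\<in>partitions_of n. c mu * jack_inner (J mu) (J nu))"
    using homogeneous_sym_jack assms by (intro jack_inner_sum_left[of _ n]) auto
  also have "\<dots> = (\<Sum>mu\<in>partitions_of n. if mu = nu then c nu * jack_inner (J nu) (J nu) else 0)"
    by (rule sum.cong) (use jack_inner_jack[OF _ nu] in auto)
  finally show ?thesis using nu by (simp add: sum.delta)
qed

text \<open>Orthogonality and nonzero self-pairings make the family independent, and it has one
  member for each partition of \<open>n\<close>.\<close>

lemma jack_spans:
  assumes "homogeneous_sym n f"
  shows "\<exists>c. \<forall>m. f m = (\<Sum>mu\<in>partitions_of n. c mu * J mu m)"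
proof (rule homogeneous_sym_spanned[OF homogeneous_sym_jack _ assms], assumption)
  fix c assume zero: "\<And>m. (\<Sum>mu\<in>partitions_of n. c mu * J mu m) = 0"
  have hom: "homogeneous_sym n (\<lambda>m. 0 :: ratfun)" by (simp add: homogeneous_sym_def)
  have "c nu = 0" if nu: "nu \<in> partitions_of n" for nu
  proof -
    have "jack_inner (\<lambda>m. 0) (J nu) = c nu * jack_inner (J nu) (J nu)"
      using zero by (intro jack_inner_jack_combination[OF _ hom nu]) simp
    \<comment> \<open>The zero series is also the empty combination, so its pairing with
      \<open>J nu\<close> vanishes.\<close>
    moreover have "jack_inner (\<lambda>m. 0) (J nu) = (\<Sum>mu\<in>{}. 0 * jack_inner (J mu) (J nu))"
      by (rule jack_inner_sum_left[OF _ hom homogeneous_sym_jack[OF nu]]) auto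
    ultimately show ?thesis using jack_inner_jack[OF nu nu] by simp
  qed
  then show "\<forall>nu\<in>partitions_of n. c nu = 0" by blast
qed

lemma jack_one_row:
  assumes n: "n \<ge> 1"
  shows "J [n] m = (if size m = n then fact n * (alpha ^ n * content_weight (1 / alpha) m) else 0)"
proof -
  let ?G = "complete_series (1 / alpha) n"
  have row: "[n] \<in> partitions_of n" using n by (simp add: partitions_of_def is_partition_def)
  obtain c where c: "\<And>m. ?G m = (\<Sum>mu\<in>partitions_of n. c mu * J mu m)"
    using jack_spans[OF homogeneous_sym_complete_series] by blast
  have "c mu = 0" if mu: "mu \<in> partitions_of n" "mu \<noteq> [n]" for mu
  proof -
    \<comment> \<open>This coefficient is the pairing of \<open>J mu\<close> with \<open>?G\<close>.
      Its monomial has shape \<open>[n]\<close>, which is dominated by no partition other than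
      \<open>[n]\<close> itself.\<close>
    have "J mu (replicate_mset n 0) = 0"
    proof (rule ccontr)
      assume "J mu (replicate_mset n 0) \<noteq> 0"
      then have "dominance_le (partition_of (shape (replicate_mset n 0))) mu"
        using mu by (intro jack_nonzero_imp_dominance_le) (simp_all add: partitions_of_def)
      moreover have "partition_of (shape (replicate_mset n 0)) = [n]"
        using n by (simp add: shape_def partition_of_def)
      ultimately show False
        using dominance_le_one_row[of mu n] mu n by (simp add: partitions_of_def)
    qed
    then have "c mu * jack_inner (J mu) (J mu) = 0"
      using jack_inner_jack_combination[OF c homogeneous_sym_complete_series mu(1)]
        jack_inner_complete_series[OF homogeneous_sym_jack[OF mu(1)]] by simp
    then show ?thesis using jack_inner_jack[OF mu(1) mu(1)] by simp
  qed
  then have "?G m = (\<Sum>mu\<in>partitions_of n. if mu = [n] then c [n] * J [n] m else 0)" for m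
    unfolding c by (intro sum.cong) auto
  then have G: "?G m = c [n] * J [n] m" for m using row by (simp add: sum.delta)
  have shape: "shape (canonical_monomial (replicate n 1)) = mset (replicate n 1)"
    by (rule shape_canonical_monomial) simp
  have "size (canonical_monomial (replicate n 1)) = n"
    using shape by (simp flip: sum_mset_shape)
  \<comment> \<open>Comparing coefficients at a squarefree monomial determines the one remaining
    multiple.\<close>
  then have "(1 / alpha) ^ n = c [n] * fact n"
    using G[of "canonical_monomial (replicate n 1)"] content_weight_squarefree[OF shape, of "1 / alpha"]
      jack_squarefree_coeff[OF row]
    by (simp add: complete_series_eq_content_weight)
  then have "fact n * alpha ^ n * c [n] = 1"
    using alpha_pos by (simp add: power_one_over field_simps)
  then have "J [n] m = fact n * alpha ^ n * ?G m"
    unfolding G by (simp flip: mult.assoc)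
  then show ?thesis by (simp add: complete_series_eq_content_weight mult.assoc)
qed

end

theorem corollary3p9:
  fixes J :: "nat list \<Rightarrow> ratfun mseries" and n :: nat
  assumes "integral_jack_family J" and "n \<ge> 1"
  shows "jack_tilde J [n] =
    (\<lambda>m. fact n * (\<Sum>\<pi>\<in>permutations_of_set {1..n}.
       ((alpha + of_nat n - 1 - of_nat (des \<pi>)) gchoose n) *
       fundamental_qsym n (Des (insertion_tableau \<pi>)) m))"
proof
  fix m
  have "jack_tilde J [n] m = (if size m = n then fact n * content_weight alpha m else 0)"
  proof (cases "size m = n")
    case True
    \<comment> \<open>The coefficient as a polynomial, to be evaluated at \<open>1 / alpha\<close>.
      There the factor \<open>alpha ^ n\<close> of \<open>jack_tilde\<close> cancels the power of
      \<open>1 / alpha\<close>, and the parameter of the weight becomes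
      \<open>alpha\<close>.\<close>
    let ?p = "smult (fact n) (\<Prod>x\<in>set_mset m. rising_poly (count m x))"
    have eval: "eval_ratpoly ?p t = fact n * (t ^ n * content_weight (1 / t) m)"
      if "t \<noteq> 0" for t :: ratfun
      using True by (simp add: eval_ratpoly_smult eval_prod_rising_poly[OF that] of_rat_fact)
    have "J [n] m = eval_ratpoly ?p alpha"
      using True alpha_pos by (simp add: jack_one_row[OF assms] eval)
    then have "jack_tilde J [n] m = alpha ^ n * eval_ratpoly ?p (1 / alpha)"
      by (simp add: jack_tilde_def subst_alpha_eval_ratpoly)
    also have "\<dots> = fact n * content_weight alpha m"
      using alpha_pos by (simp add: eval power_one_over)
    finally show ?thesis using True by simp
  next
    case False
    then have "J [n] m = 0" by (simp add: jack_one_row[OF assms])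
    \<comment> \<open>The zero polynomial supplies the fact that substitution maps 0 to 0.\<close>
    then show ?thesis
      using False subst_alpha_eval_ratpoly[of "1 / alpha" 0] by (simp add: jack_tilde_def)
  qed
  then show "jack_tilde J [n] m = fact n * (\<Sum>\<pi>\<in>permutations_of_set {1..n}.
       ((alpha + of_nat n - 1 - of_nat (des \<pi>)) gchoose n) *
       fundamental_qsym n (Des (insertion_tableau \<pi>)) m)"
    unfolding sum_gchoose_fundamental_qsym by simp
qed

end
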